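(* Let \(\mathcal U,\mathcal V\) be universes and \(P_{\mathcal U}:\mathcal U\) a proposition, and let \(\mathcal T\) be any universe. If the poset \(\mathcal L_{\mathcal V}(P_{\mathcal U})\) has suprema for all subsets \(\mathcal L_{\mathcal V}(P_{\mathcal U})\to\Omega_{\mathcal T}\), then \(P_{\mathcal U}\) is \(\mathcal V\)-small.
   Context: Work in univalent foundations (intensional Martin-Löf type theory with universes, function and propositional extensionality, propositional truncations). \(\Omega_{\mathcal V}\) is the type of propositions in \(\mathcal V\). Define \(\mathcal L_{\mathcal V}(P_{\mathcal U}):=\Sigma_{Q:\Omega_{\mathcal V}}(Q\to P_{\mathcal U})\), ordered by implication of first components (it is a subtype of \(\Omega_{\mathcal V}\) closed under suprema of families indexed by types in \(\mathcal V\)). A subset of a type \(X\) is a map \(S:X\to\Omega_{\mathcal T}\); a supremum of \(S\) is a least upper bound of \(\{x\mid S(x)\}\). A type is \(\mathcal V\)-small if it is equivalent to a type in \(\mathcal V\). *)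

theory Defs
  imports Main
begin

text \<open>
  HOL is classical and has no hierarchy of type universes: under a shallow reading every
  proposition would be small. The univalent foundations are therefore deeply embedded, as an
  intensional Martin-Loef type theory with Russell universes \<open>Univ i : Univ (i + 1)\<close> in the
  style of the appendix of the HoTT book, but without cumulativity: a type lives in exactly the
  universe given by maxima and successors of levels. A quantification over universes is a
  quantification over their levels.
\<close>


section \<open>Raw syntax\<close>

text \<open>
  Everything except universes, dependent products, abstraction and application is a constant with
  a closed type. The numerical arguments of a constant are universe levels.
\<close>

datatype const =
    EmptyT nat | EmptyInd nat nat
  | UnitT nat | Star nat | UnitInd nat nat
  | NatT | ZeroC | SuccC | NatInd nat
  | SumT nat nat | LeftC nat nat | RightC nat nat | SumInd nat nat nat
  | SigT nat nat | PairC nat nat | SigInd nat nat nat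
  | IdT nat | Refl nat | IdInd nat nat
  | Trunc nat | TruncIn nat | TruncProp nat | TruncRec nat nat
  | FunExt nat nat
  | PropExt nat

datatype tm =
    Var nat  \<comment> \<open>de Bruijn index\<close>
  | Univ nat
  | Pi tm tm
  | Lam tm tm
  | App tm tm
  | Const const

primrec lift :: "tm \<Rightarrow> nat \<Rightarrow> tm" where
  "lift (Var n) k = Var (if n < k then n else Suc n)"
| "lift (Univ i) k = Univ i"
| "lift (Pi A B) k = Pi (lift A k) (lift B (Suc k))"
| "lift (Lam A b) k = Lam (lift A k) (lift b (Suc k))"
| "lift (App f a) k = App (lift f k) (lift a k)"
| "lift (Const c) k = Const c"

primrec subst :: "tm \<Rightarrow> tm \<Rightarrow> nat \<Rightarrow> tm" where
  "subst (Var n) s k = (if n < k then Var n else if n = k then s else Var (n - 1))"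
| "subst (Univ i) s k = Univ i"
| "subst (Pi A B) s k = Pi (subst A s k) (subst B (lift s 0) (Suc k))"
| "subst (Lam A b) s k = Lam (subst A s k) (subst b (lift s 0) (Suc k))"
| "subst (App f a) s k = App (subst f s k) (subst a s k)"
| "subst (Const c) s k = Const c"


section \<open>Named surface syntax\<close>

text \<open>
  To write terms with named variables, an expression is a function from the number of binders
  above it to the raw term that it denotes there. The variable bound below \<open>n\<close> binders has index
  \<open>m - (n + 1)\<close> when it occurs below \<open>m\<close> binders, so weakening is implicit. A closed expression
  \<open>e\<close> denotes the raw term \<open>e 0\<close>.
\<close>

type_synonym expr = "nat \<Rightarrow> tm"

definition PI :: "expr \<Rightarrow> (expr \<Rightarrow> expr) \<Rightarrow> expr" where
  "PI A B = (\<lambda>n. Pi (A n) (B (\<lambda>m. Var (m - Suc n)) (Suc n)))"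

definition LAM :: "expr \<Rightarrow> (expr \<Rightarrow> expr) \<Rightarrow> expr" where
  "LAM A b = (\<lambda>n. Lam (A n) (b (\<lambda>m. Var (m - Suc n)) (Suc n)))"

definition app :: "expr \<Rightarrow> expr \<Rightarrow> expr" (infixl "\<cdot>" 80) where
  "f \<cdot> a = (\<lambda>n. App (f n) (a n))"

definition U :: "nat \<Rightarrow> expr" where
  "U i = (\<lambda>n. Univ i)"

definition con :: "const \<Rightarrow> expr" where
  "con c = (\<lambda>n. Const c)"

definition arr :: "expr \<Rightarrow> expr \<Rightarrow> expr" (infixr "\<rightarrow>" 65) where
  "A \<rightarrow> B = PI A (\<lambda>_. B)"

syntax
  "_PI" :: "pttrn \<Rightarrow> expr \<Rightarrow> expr \<Rightarrow> expr" ("(3\<Prod>_:_./ _)" [0, 0, 60] 60)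
  "_LAM" :: "pttrn \<Rightarrow> expr \<Rightarrow> expr \<Rightarrow> expr" ("(3\<^bold>\<lambda>_:_./ _)" [0, 0, 60] 60)
translations
  "\<Prod>x:A. B" \<rightleftharpoons> "CONST PI A (\<lambda>x. B)"
  "\<^bold>\<lambda>x:A. b" \<rightleftharpoons> "CONST LAM A (\<lambda>x. b)"

text \<open>\<open>ID i A x y\<close> is the identity type of \<open>A : Univ i\<close>.\<close>

definition ID :: "nat \<Rightarrow> expr \<Rightarrow> expr \<Rightarrow> expr \<Rightarrow> expr" where
  "ID i A x y = con (IdT i) \<cdot> A \<cdot> x \<cdot> y"

text \<open>\<open>SIG i j A B\<close> is the sum of the family \<open>B x : Univ j\<close> over \<open>x : A : Univ i\<close>.\<close>

definition SIG :: "nat \<Rightarrow> nat \<Rightarrow> expr \<Rightarrow> (expr \<Rightarrow> expr) \<Rightarrow> expr" where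
  "SIG i j A B = con (SigT i j) \<cdot> A \<cdot> (\<^bold>\<lambda>x:A. B x)"

definition times :: "nat \<Rightarrow> nat \<Rightarrow> expr \<Rightarrow> expr \<Rightarrow> expr" where
  "times i j A B = SIG i j A (\<lambda>_. B)"

text \<open>Propositions in the sense of univalent foundations: types with at most one element.\<close>

definition is_prop :: "nat \<Rightarrow> expr \<Rightarrow> expr" where
  "is_prop i A = (\<Prod>x:A. \<Prod>y:A. ID i A x y)"


section \<open>Types of the constants\<close>

primrec const_type :: "const \<Rightarrow> expr" where
  "const_type (EmptyT i) = U i"
| "const_type (EmptyInd i k) = (\<Prod>C:con (EmptyT i) \<rightarrow> U k. \<Prod>z:con (EmptyT i). C \<cdot> z)"

| "const_type (UnitT i) = U i"
| "const_type (Star i) = con (UnitT i)"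
| "const_type (UnitInd i k) =
    (\<Prod>C:con (UnitT i) \<rightarrow> U k. C \<cdot> con (Star i) \<rightarrow> (\<Prod>z:con (UnitT i). C \<cdot> z))"

| "const_type NatT = U 0"
| "const_type ZeroC = con NatT"
| "const_type SuccC = con NatT \<rightarrow> con NatT"
| "const_type (NatInd k) =
    (\<Prod>C:con NatT \<rightarrow> U k. C \<cdot> con ZeroC \<rightarrow>
      (\<Prod>n:con NatT. C \<cdot> n \<rightarrow> C \<cdot> (con SuccC \<cdot> n)) \<rightarrow> (\<Prod>n:con NatT. C \<cdot> n))"

| "const_type (SumT i j) = U i \<rightarrow> U j \<rightarrow> U (max i j)"
| "const_type (LeftC i j) = (\<Prod>A:U i. \<Prod>B:U j. A \<rightarrow> con (SumT i j) \<cdot> A \<cdot> B)"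
| "const_type (RightC i j) = (\<Prod>A:U i. \<Prod>B:U j. B \<rightarrow> con (SumT i j) \<cdot> A \<cdot> B)"
| "const_type (SumInd i j k) =
    (\<Prod>A:U i. \<Prod>B:U j. \<Prod>C:con (SumT i j) \<cdot> A \<cdot> B \<rightarrow> U k.
      (\<Prod>a:A. C \<cdot> (con (LeftC i j) \<cdot> A \<cdot> B \<cdot> a)) \<rightarrow>
      (\<Prod>b:B. C \<cdot> (con (RightC i j) \<cdot> A \<cdot> B \<cdot> b)) \<rightarrow>
      (\<Prod>z:con (SumT i j) \<cdot> A \<cdot> B. C \<cdot> z))"

| "const_type (SigT i j) = (\<Prod>A:U i. (A \<rightarrow> U j) \<rightarrow> U (max i j))"
| "const_type (PairC i j) =
    (\<Prod>A:U i. \<Prod>B:A \<rightarrow> U j. \<Prod>a:A. B \<cdot> a \<rightarrow> con (SigT i j) \<cdot> A \<cdot> B)"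
| "const_type (SigInd i j k) =
    (\<Prod>A:U i. \<Prod>B:A \<rightarrow> U j. \<Prod>C:con (SigT i j) \<cdot> A \<cdot> B \<rightarrow> U k.
      (\<Prod>a:A. \<Prod>b:B \<cdot> a. C \<cdot> (con (PairC i j) \<cdot> A \<cdot> B \<cdot> a \<cdot> b)) \<rightarrow>
      (\<Prod>z:con (SigT i j) \<cdot> A \<cdot> B. C \<cdot> z))"

| "const_type (IdT i) = (\<Prod>A:U i. A \<rightarrow> A \<rightarrow> U i)"
| "const_type (Refl i) = (\<Prod>A:U i. \<Prod>x:A. ID i A x x)"
| "const_type (IdInd i k) =
    (\<Prod>A:U i. \<Prod>C:(\<Prod>x:A. \<Prod>y:A. ID i A x y \<rightarrow> U k).
      (\<Prod>x:A. C \<cdot> x \<cdot> x \<cdot> (con (Refl i) \<cdot> A \<cdot> x)) \<rightarrow>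
      (\<Prod>x:A. \<Prod>y:A. \<Prod>p:ID i A x y. C \<cdot> x \<cdot> y \<cdot> p))"

| "const_type (Trunc i) = U i \<rightarrow> U i"
| "const_type (TruncIn i) = (\<Prod>A:U i. A \<rightarrow> con (Trunc i) \<cdot> A)"
| "const_type (TruncProp i) = (\<Prod>A:U i. is_prop i (con (Trunc i) \<cdot> A))"
| "const_type (TruncRec i k) =
    (\<Prod>A:U i. \<Prod>P:U k. is_prop k P \<rightarrow> (A \<rightarrow> P) \<rightarrow> con (Trunc i) \<cdot> A \<rightarrow> P)"

| "const_type (FunExt i j) =
    (\<Prod>A:U i. \<Prod>B:A \<rightarrow> U j. \<Prod>f:(\<Prod>x:A. B \<cdot> x). \<Prod>g:(\<Prod>x:A. B \<cdot> x).
      (\<Prod>x:A. ID j (B \<cdot> x) (f \<cdot> x) (g \<cdot> x)) \<rightarrow> ID (max i j) (\<Prod>x:A. B \<cdot> x) f g)"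
| "const_type (PropExt i) =
    (\<Prod>P:U i. \<Prod>Q:U i. is_prop i P \<rightarrow> is_prop i Q \<rightarrow>
      (P \<rightarrow> Q) \<rightarrow> (Q \<rightarrow> P) \<rightarrow> ID (Suc i) (U i) P Q)"


section \<open>Computation rules\<close>

text \<open>
  A computation rule \<open>l \<equiv> r : T\<close> in a telescope of parameters is given by its closed form, the
  judgmental equality of the abstractions of \<open>l\<close> and \<open>r\<close> over the telescope. A scheme
  takes a binder \<open>q\<close>, which is \<^const>\<open>LAM\<close> for the two sides and \<^const>\<open>PI\<close> for the type, and
  a selector \<open>s\<close> applied to \<open>l\<close>, \<open>r\<close> and \<open>T\<close>. Truncation satisfies its computation rule only
  propositionally, which is automatic.
\<close>

type_synonym scheme = "(expr \<Rightarrow> (expr \<Rightarrow> expr) \<Rightarrow> expr) \<Rightarrow> (expr \<Rightarrow> expr \<Rightarrow> expr \<Rightarrow> expr) \<Rightarrow> expr"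

definition lhs :: "scheme \<Rightarrow> expr" where
  "lhs R = R LAM (\<lambda>l r T. l)"

definition rhs :: "scheme \<Rightarrow> expr" where
  "rhs R = R LAM (\<lambda>l r T. r)"

definition type_of :: "scheme \<Rightarrow> expr" where
  "type_of R = R PI (\<lambda>l r T. T)"

inductive computation :: "scheme \<Rightarrow> bool" where
  unit: "computation (\<lambda>q s.
    q (con (UnitT i) \<rightarrow> U k) (\<lambda>C. q (C \<cdot> con (Star i)) (\<lambda>c.
      s (con (UnitInd i k) \<cdot> C \<cdot> c \<cdot> con (Star i)) c (C \<cdot> con (Star i)))))"
| zero: "computation (\<lambda>q s.
    q (con NatT \<rightarrow> U k) (\<lambda>C. q (C \<cdot> con ZeroC) (\<lambda>c.
    q (\<Prod>n:con NatT. C \<cdot> n \<rightarrow> C \<cdot> (con SuccC \<cdot> n)) (\<lambda>h.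
      s (con (NatInd k) \<cdot> C \<cdot> c \<cdot> h \<cdot> con ZeroC) c (C \<cdot> con ZeroC)))))"
| succ: "computation (\<lambda>q s.
    q (con NatT \<rightarrow> U k) (\<lambda>C. q (C \<cdot> con ZeroC) (\<lambda>c.
    q (\<Prod>n:con NatT. C \<cdot> n \<rightarrow> C \<cdot> (con SuccC \<cdot> n)) (\<lambda>h. q (con NatT) (\<lambda>n.
      s (con (NatInd k) \<cdot> C \<cdot> c \<cdot> h \<cdot> (con SuccC \<cdot> n))
        (h \<cdot> n \<cdot> (con (NatInd k) \<cdot> C \<cdot> c \<cdot> h \<cdot> n))
        (C \<cdot> (con SuccC \<cdot> n)))))))"
| left: "computation (\<lambda>q s.
    q (U i) (\<lambda>A. q (U j) (\<lambda>B. q (con (SumT i j) \<cdot> A \<cdot> B \<rightarrow> U k) (\<lambda>C.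
    q (\<Prod>a:A. C \<cdot> (con (LeftC i j) \<cdot> A \<cdot> B \<cdot> a)) (\<lambda>f.
    q (\<Prod>b:B. C \<cdot> (con (RightC i j) \<cdot> A \<cdot> B \<cdot> b)) (\<lambda>g. q A (\<lambda>a.
      s (con (SumInd i j k) \<cdot> A \<cdot> B \<cdot> C \<cdot> f \<cdot> g \<cdot> (con (LeftC i j) \<cdot> A \<cdot> B \<cdot> a))
        (f \<cdot> a)
        (C \<cdot> (con (LeftC i j) \<cdot> A \<cdot> B \<cdot> a)))))))))"
| right: "computation (\<lambda>q s.
    q (U i) (\<lambda>A. q (U j) (\<lambda>B. q (con (SumT i j) \<cdot> A \<cdot> B \<rightarrow> U k) (\<lambda>C.
    q (\<Prod>a:A. C \<cdot> (con (LeftC i j) \<cdot> A \<cdot> B \<cdot> a)) (\<lambda>f.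
    q (\<Prod>b:B. C \<cdot> (con (RightC i j) \<cdot> A \<cdot> B \<cdot> b)) (\<lambda>g. q B (\<lambda>b.
      s (con (SumInd i j k) \<cdot> A \<cdot> B \<cdot> C \<cdot> f \<cdot> g \<cdot> (con (RightC i j) \<cdot> A \<cdot> B \<cdot> b))
        (g \<cdot> b)
        (C \<cdot> (con (RightC i j) \<cdot> A \<cdot> B \<cdot> b)))))))))"
| pair: "computation (\<lambda>q s.
    q (U i) (\<lambda>A. q (A \<rightarrow> U j) (\<lambda>B. q (con (SigT i j) \<cdot> A \<cdot> B \<rightarrow> U k) (\<lambda>C.
    q (\<Prod>a:A. \<Prod>b:B \<cdot> a. C \<cdot> (con (PairC i j) \<cdot> A \<cdot> B \<cdot> a \<cdot> b)) (\<lambda>g.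
    q A (\<lambda>a. q (B \<cdot> a) (\<lambda>b.
      s (con (SigInd i j k) \<cdot> A \<cdot> B \<cdot> C \<cdot> g \<cdot> (con (PairC i j) \<cdot> A \<cdot> B \<cdot> a \<cdot> b))
        (g \<cdot> a \<cdot> b)
        (C \<cdot> (con (PairC i j) \<cdot> A \<cdot> B \<cdot> a \<cdot> b)))))))))"
| refl: "computation (\<lambda>q s.
    q (U i) (\<lambda>A. q (\<Prod>x:A. \<Prod>y:A. ID i A x y \<rightarrow> U k) (\<lambda>C.
    q (\<Prod>x:A. C \<cdot> x \<cdot> x \<cdot> (con (Refl i) \<cdot> A \<cdot> x)) (\<lambda>c. q A (\<lambda>x.
      s (con (IdInd i k) \<cdot> A \<cdot> C \<cdot> c \<cdot> x \<cdot> x \<cdot> (con (Refl i) \<cdot> A \<cdot> x))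
        (c \<cdot> x)
        (C \<cdot> x \<cdot> x \<cdot> (con (Refl i) \<cdot> A \<cdot> x)))))))"


section \<open>Judgments\<close>

text \<open>The head of a context is the type of the variable with index \<open>0\<close>.\<close>

inductive wf_ctx :: "tm list \<Rightarrow> bool" ("\<turnstile> _" [50] 50)
  and has_type :: "tm list \<Rightarrow> tm \<Rightarrow> tm \<Rightarrow> bool" ("_ \<turnstile> _ : _" [50, 50, 50] 50)
  and jeq :: "tm list \<Rightarrow> tm \<Rightarrow> tm \<Rightarrow> tm \<Rightarrow> bool" ("_ \<turnstile> _ \<equiv> _ : _" [50, 50, 50, 50] 50)
where
  ctx_empty: "\<turnstile> []"
| ctx_ext: "\<turnstile> \<Gamma> \<Longrightarrow> \<Gamma> \<turnstile> A : Univ i \<Longrightarrow> \<turnstile> A # \<Gamma>"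

| ty_var: "\<turnstile> \<Gamma> \<Longrightarrow> n < length \<Gamma> \<Longrightarrow> \<Gamma> \<turnstile> Var n : ((\<lambda>A. lift A 0) ^^ Suc n) (\<Gamma> ! n)"
| ty_univ: "\<turnstile> \<Gamma> \<Longrightarrow> \<Gamma> \<turnstile> Univ i : Univ (Suc i)"
| ty_pi: "\<Gamma> \<turnstile> A : Univ i \<Longrightarrow> A # \<Gamma> \<turnstile> B : Univ j \<Longrightarrow> \<Gamma> \<turnstile> Pi A B : Univ (max i j)"
| ty_lam: "\<Gamma> \<turnstile> A : Univ i \<Longrightarrow> A # \<Gamma> \<turnstile> b : B \<Longrightarrow> \<Gamma> \<turnstile> Lam A b : Pi A B"
| ty_app: "\<Gamma> \<turnstile> f : Pi A B \<Longrightarrow> \<Gamma> \<turnstile> a : A \<Longrightarrow> \<Gamma> \<turnstile> App f a : subst B a 0"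
| ty_const: "\<turnstile> \<Gamma> \<Longrightarrow> \<Gamma> \<turnstile> Const c : const_type c 0"
| ty_conv: "\<Gamma> \<turnstile> a : A \<Longrightarrow> \<Gamma> \<turnstile> A \<equiv> B : Univ i \<Longrightarrow> \<Gamma> \<turnstile> a : B"

| eq_refl: "\<Gamma> \<turnstile> a : A \<Longrightarrow> \<Gamma> \<turnstile> a \<equiv> a : A"
| eq_sym: "\<Gamma> \<turnstile> a \<equiv> b : A \<Longrightarrow> \<Gamma> \<turnstile> b \<equiv> a : A"
| eq_trans: "\<Gamma> \<turnstile> a \<equiv> b : A \<Longrightarrow> \<Gamma> \<turnstile> b \<equiv> c : A \<Longrightarrow> \<Gamma> \<turnstile> a \<equiv> c : A"
| eq_conv: "\<Gamma> \<turnstile> a \<equiv> b : A \<Longrightarrow> \<Gamma> \<turnstile> A \<equiv> B : Univ i \<Longrightarrow> \<Gamma> \<turnstile> a \<equiv> b : B"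
| eq_pi: "\<Gamma> \<turnstile> A : Univ i \<Longrightarrow> \<Gamma> \<turnstile> A \<equiv> A' : Univ i \<Longrightarrow> A # \<Gamma> \<turnstile> B \<equiv> B' : Univ j \<Longrightarrow>
    \<Gamma> \<turnstile> Pi A B \<equiv> Pi A' B' : Univ (max i j)"
| eq_lam: "\<Gamma> \<turnstile> A : Univ i \<Longrightarrow> \<Gamma> \<turnstile> A \<equiv> A' : Univ i \<Longrightarrow> A # \<Gamma> \<turnstile> b \<equiv> b' : B \<Longrightarrow>
    \<Gamma> \<turnstile> Lam A b \<equiv> Lam A' b' : Pi A B"
| eq_app: "\<Gamma> \<turnstile> f \<equiv> f' : Pi A B \<Longrightarrow> \<Gamma> \<turnstile> a \<equiv> a' : A \<Longrightarrow>
    \<Gamma> \<turnstile> App f a \<equiv> App f' a' : subst B a 0"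
| eq_beta: "\<Gamma> \<turnstile> A : Univ i \<Longrightarrow> A # \<Gamma> \<turnstile> b : B \<Longrightarrow> \<Gamma> \<turnstile> a : A \<Longrightarrow>
    \<Gamma> \<turnstile> App (Lam A b) a \<equiv> subst b a 0 : subst B a 0"
| eq_eta: "\<Gamma> \<turnstile> f : Pi A B \<Longrightarrow> \<Gamma> \<turnstile> f \<equiv> Lam A (App (lift f 0) (Var 0)) : Pi A B"
| eq_comp: "\<turnstile> \<Gamma> \<Longrightarrow> computation R \<Longrightarrow> \<Gamma> \<turnstile> lhs R 0 \<equiv> rhs R 0 : type_of R 0"

text \<open>A statement of univalent foundations holds if the closed type expressing it has an element.\<close>

definition holds_in_UF :: "expr \<Rightarrow> bool" where
  "holds_in_UF T \<longleftrightarrow> (\<exists>a. [] \<turnstile> a : T 0)"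


section \<open>Subsets, suprema and smallness in the type theory\<close>

definition pr1 :: "nat \<Rightarrow> nat \<Rightarrow> expr \<Rightarrow> (expr \<Rightarrow> expr) \<Rightarrow> expr \<Rightarrow> expr" where
  "pr1 i j A B z =
    con (SigInd i j i) \<cdot> A \<cdot> (\<^bold>\<lambda>x:A. B x) \<cdot> (\<^bold>\<lambda>_:SIG i j A B. A) \<cdot> (\<^bold>\<lambda>a:A. \<^bold>\<lambda>b:B a. a) \<cdot> z"

text \<open>The type of propositions in \<open>Univ v\<close>, an element of \<open>Univ (v + 1)\<close>.\<close>

definition Omega :: "nat \<Rightarrow> expr" where
  "Omega v = SIG (Suc v) v (U v) (is_prop v)"

definition holds :: "nat \<Rightarrow> expr \<Rightarrow> expr" where
  "holds v Q = pr1 (Suc v) v (U v) (is_prop v) Q"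

text \<open>
  \<open>Lift u v P\<close>, for \<open>P : Univ u\<close>, is the type \<open>\<Sigma> Q : Omega v. (Q \<rightarrow> P)\<close>. It lives in the
  universe of level \<open>lev u v\<close>.
\<close>

abbreviation lev :: "nat \<Rightarrow> nat \<Rightarrow> nat" where
  "lev u v \<equiv> max (Suc v) (max v u)"

definition Lift :: "nat \<Rightarrow> nat \<Rightarrow> expr \<Rightarrow> expr" where
  "Lift u v P = SIG (Suc v) (max v u) (Omega v) (\<lambda>Q. holds v Q \<rightarrow> P)"

definition Lift_prop :: "nat \<Rightarrow> nat \<Rightarrow> expr \<Rightarrow> expr \<Rightarrow> expr" where
  "Lift_prop u v P x = pr1 (Suc v) (max v u) (Omega v) (\<lambda>Q. holds v Q \<rightarrow> P) x"

definition Lift_le :: "nat \<Rightarrow> nat \<Rightarrow> expr \<Rightarrow> expr \<Rightarrow> expr \<Rightarrow> expr" where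
  "Lift_le u v P x y = (holds v (Lift_prop u v P x) \<rightarrow> holds v (Lift_prop u v P y))"

definition is_upper_bound :: "nat \<Rightarrow> nat \<Rightarrow> nat \<Rightarrow> expr \<Rightarrow> expr \<Rightarrow> expr \<Rightarrow> expr" where
  "is_upper_bound u v t P S y = (\<Prod>x:Lift u v P. holds t (S \<cdot> x) \<rightarrow> Lift_le u v P x y)"

abbreviation sup_lev :: "nat \<Rightarrow> nat \<Rightarrow> nat \<Rightarrow> nat" where
  "sup_lev u v t \<equiv> max (lev u v) (max t v)"

definition is_sup :: "nat \<Rightarrow> nat \<Rightarrow> nat \<Rightarrow> expr \<Rightarrow> expr \<Rightarrow> expr \<Rightarrow> expr" where
  "is_sup u v t P S y =
    times (sup_lev u v t) (sup_lev u v t)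
      (is_upper_bound u v t P S y)
      (\<Prod>z:Lift u v P. is_upper_bound u v t P S z \<rightarrow> Lift_le u v P y z)"

definition has_subset_sups :: "nat \<Rightarrow> nat \<Rightarrow> nat \<Rightarrow> expr \<Rightarrow> expr" where
  "has_subset_sups u v t P =
    (\<Prod>S:Lift u v P \<rightarrow> Omega t. SIG (lev u v) (sup_lev u v t) (Lift u v P) (is_sup u v t P S))"

text \<open>An equivalence is a map with a section and a retraction.\<close>

definition is_equiv :: "nat \<Rightarrow> nat \<Rightarrow> expr \<Rightarrow> expr \<Rightarrow> expr \<Rightarrow> expr" where
  "is_equiv i j A B f =
    times (max i j) (max i j)
      (SIG (max i j) j (B \<rightarrow> A) (\<lambda>g. \<Prod>y:B. ID j B (f \<cdot> (g \<cdot> y)) y))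
      (SIG (max i j) i (B \<rightarrow> A) (\<lambda>h. \<Prod>x:A. ID i A (h \<cdot> (f \<cdot> x)) x))"

definition Equiv :: "nat \<Rightarrow> nat \<Rightarrow> expr \<Rightarrow> expr \<Rightarrow> expr" where
  "Equiv i j A B = SIG (max i j) (max i j) (A \<rightarrow> B) (is_equiv i j A B)"

definition is_small :: "nat \<Rightarrow> nat \<Rightarrow> expr \<Rightarrow> expr" where
  "is_small u v X = SIG (Suc v) (max v u) (U v) (\<lambda>Y. Equiv v u Y X)"

end

theory Submission
  imports Defs
begin

text \<open>
  Apply the hypothesis to the subset of all elements of the lifting and let \<open>y\<close> be its supremum, with
  underlying proposition \<open>Q\<close>. The second component of \<open>y\<close> maps \<open>Q\<close> to \<open>P\<close>. Conversely, an element of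
  \<open>P\<close> makes the pair of the unit type and the constant map an element of the lifting; it lies
  below \<open>y\<close>, so \<open>Q\<close> holds. Two propositions that imply each other are equivalent, and \<open>Q\<close> lives in
  the universe of level \<open>v\<close>.
\<close>

section \<open>Weakening and substitution\<close>

text \<open>\<open>holds_in_UF\<close> asks for a derivation, so the argument is a construction of
  typed raw terms. What shapes it is judgmental equality: the computation rule of sums is available
  only as an equality between closed abstractions, and the projection of a pair equals its component
  only up to \<open>jeq\<close>, never syntactically. Weakening and substitution therefore have to
  be admissible before that rule can be instantiated at arbitrary terms, and most later steps are
  conversions along the instances. Lemmas about equalities carry the typings that they need as
  premises, in place of a general presupposition theorem. Where only inhabitation matters, the
  element is hidden under an existential quantifier. Since universes are not cumulative, the trivial
  proposition occurs at two levels: \<open>Unit t\<close> defines the subset of all elements, and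
  \<open>Unit v\<close> is the first component of the element of the lifting built from a point of
  \<open>P\<close>.\<close>

lemma lift_lift: "i \<le> k \<Longrightarrow> lift (lift t k) i = lift (lift t i) (Suc k)"
  by (induction t arbitrary: i k) auto

lemma subst_lift [simp]: "subst (lift t k) s k = t"
  by (induction t arbitrary: s k) auto

text \<open>A variable inserted at or below the substituted index shifts that index, whereas one
  inserted at or above it leaves the index alone. This is why the commutation of \<open>lift\<close>
  with \<open>subst\<close> splits into two identities.\<close>

lemma lift_subst_le: "i \<le> k \<Longrightarrow> lift (subst t s k) i = subst (lift t i) (lift s i) (Suc k)"
  by (induction t arbitrary: i k s) (auto simp: lift_lift)

lemma lift_subst_ge: "k \<le> i \<Longrightarrow> lift (subst t s k) i = subst (lift t (Suc i)) (lift s i) k"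
  by (induction t arbitrary: i k s) (auto simp: lift_lift)

text \<open>The type \<open>subst B a 0\<close> of a dependent application has to be stable under a
  further substitution; this identity supplies the application and beta cases of the substitution
  theorem.\<close>

lemma subst_subst:
  "i \<le> k \<Longrightarrow> subst (subst t s i) a k = subst (subst t (lift a i) (Suc k)) (subst s a k) i"
  by (induction t arbitrary: i k s a) (auto simp: lift_lift lift_subst_le)

lemmas expr_simps = PI_def LAM_def app_def U_def con_def arr_def ID_def SIG_def is_prop_def

text \<open>Types of constants contain no free variables, so the rule for constants survives
  weakening and substitution unchanged. The closed form of the computation rules has the same effect
  for \<open>eq_comp\<close>.\<close>

lemma const_type_closed [simp]:
  "lift (const_type c 0) k = const_type c 0" "subst (const_type c 0) s k = const_type c 0"
  by (induction c) (simp_all add: expr_simps)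

lemma computation_closed:
  assumes "computation R"
  shows "lift (lhs R 0) k = lhs R 0" "lift (rhs R 0) k = rhs R 0" "lift (type_of R 0) k = type_of R 0"
    "subst (lhs R 0) s k = lhs R 0" "subst (rhs R 0) s k = rhs R 0"
    "subst (type_of R 0) s k = type_of R 0"
  using assms by (induction; simp add: expr_simps lhs_def rhs_def type_of_def)+

section \<open>Admissibility of weakening\<close>

lemma ctx_of_typing: "\<Gamma> \<turnstile> a : A \<Longrightarrow> \<turnstile> \<Gamma>"
proof -
  have "(\<turnstile> \<Delta> \<longrightarrow> True) \<and> (\<Gamma> \<turnstile> a : A \<longrightarrow> \<turnstile> \<Gamma>) \<and> (\<Delta> \<turnstile> b \<equiv> c : B \<longrightarrow> True)" for \<Delta> b c B
    by (induction rule: wf_ctx_has_type_jeq.induct) auto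
  then show "\<Gamma> \<turnstile> a : A \<Longrightarrow> \<turnstile> \<Gamma>" by blast
qed

text \<open>The insertion point may lie at any depth \<open>k\<close>, because the premises of rules
  with binders extend the context above it. Each of the \<open>k\<close> declarations above it is
  lifted at its own depth.\<close>

inductive ctx_insert :: "nat \<Rightarrow> tm list \<Rightarrow> tm list \<Rightarrow> bool" where
  here: "\<Gamma> \<turnstile> X : Univ i \<Longrightarrow> ctx_insert 0 \<Gamma> (X # \<Gamma>)"
| there: "ctx_insert k \<Gamma> \<Gamma>' \<Longrightarrow> ctx_insert (Suc k) (A # \<Gamma>) (lift A k # \<Gamma>')"

text \<open>The variable case of weakening: only variables declared below the insertion point are
  renumbered, while the types of all variables are lifted.\<close>

lemma ctx_insert_nth:
  assumes "ctx_insert k \<Gamma> \<Gamma>'" "n < length \<Gamma>"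
  defines "m \<equiv> if n < k then n else Suc n"
  shows "m < length \<Gamma>' \<and>
    ((\<lambda>A. lift A 0) ^^ Suc m) (\<Gamma>' ! m) = lift (((\<lambda>A. lift A 0) ^^ Suc n) (\<Gamma> ! n)) k"
  using assms(1,2) unfolding m_def
proof (induction arbitrary: n)
  case (here \<Gamma> X i)
  then show ?case by (simp add: lift_lift)
next
  case (there k \<Gamma> \<Gamma>' A)
  show ?case
  proof (cases n)
    case 0
    then show ?thesis by (simp add: lift_lift)
  next
    case (Suc l)
    then show ?thesis using there.IH[of l] there.prems
      by (cases "l < k") (simp_all add: lift_lift[of 0])
  qed
qed

text \<open>The judgments are defined mutually and so are treated by one simultaneous induction over
  all insertions. Premises under a binder use the insertion point \<open>Suc k\<close>; dependent
  application and beta rely on \<open>lift_subst_ge\<close> to move the lifting inside the result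
  type.\<close>

lemma
  shows weaken_ctx: "\<turnstile> \<Gamma> \<Longrightarrow> ctx_insert k \<Gamma> \<Gamma>' \<Longrightarrow> \<turnstile> \<Gamma>'"
    and weaken_typing_at: "\<Gamma> \<turnstile> a : A \<Longrightarrow> ctx_insert k \<Gamma> \<Gamma>' \<Longrightarrow> \<Gamma>' \<turnstile> lift a k : lift A k"
    and weaken_eq_at:
      "\<Gamma> \<turnstile> a \<equiv> b : A \<Longrightarrow> ctx_insert k \<Gamma> \<Gamma>' \<Longrightarrow> \<Gamma>' \<turnstile> lift a k \<equiv> lift b k : lift A k"
proof (induction arbitrary: k \<Gamma>' and k \<Gamma>' and k \<Gamma>' rule: wf_ctx_has_type_jeq.inducts)
  case ctx_empty
  then show ?case by cases (auto intro: wf_ctx_has_type_jeq.ctx_empty wf_ctx_has_type_jeq.ctx_ext)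
next
  case (ctx_ext \<Gamma> A i)
  from ctx_ext.prems show ?case
  proof cases
    case (here X j)
    then show ?thesis
      using ctx_ext.hyps by (auto intro: wf_ctx_has_type_jeq.ctx_ext)
  next
    case there
    with ctx_ext.IH show ?thesis
      by (metis wf_ctx_has_type_jeq.ctx_ext lift.simps(2) subst.simps(2))
  qed
next
  case (ty_var \<Gamma> n)
  then show ?case
    using ctx_insert_nth[OF ty_var.prems ty_var.hyps(2)]
      wf_ctx_has_type_jeq.ty_var[OF ty_var.IH[OF ty_var.prems]]
    by (metis lift.simps(1))
next
  case (ty_pi \<Gamma> A i B j)
  show ?case
    using ty_pi.IH(1)[OF ty_pi.prems] ty_pi.IH(2)[OF ctx_insert.there[OF ty_pi.prems]]
    by (simp add: wf_ctx_has_type_jeq.ty_pi)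
next
  case (ty_lam \<Gamma> A i b B)
  show ?case
    using ty_lam.IH(1)[OF ty_lam.prems] ty_lam.IH(2)[OF ctx_insert.there[OF ty_lam.prems]]
    by (auto intro: wf_ctx_has_type_jeq.ty_lam)
next
  case (ty_app \<Gamma> f A B a)
  show ?case
    using ty_app.IH(1)[OF ty_app.prems] ty_app.IH(2)[OF ty_app.prems]
    by (auto simp: lift_subst_ge intro: wf_ctx_has_type_jeq.ty_app)
next
  case (ty_conv \<Gamma> a A B i)
  show ?case
    using ty_conv.IH(1)[OF ty_conv.prems] ty_conv.IH(2)[OF ty_conv.prems]
    by (auto intro: wf_ctx_has_type_jeq.ty_conv)
next
  case (eq_trans \<Gamma> a b A c)
  show ?case
    using eq_trans.IH(1)[OF eq_trans.prems] eq_trans.IH(2)[OF eq_trans.prems]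
    by (auto intro: wf_ctx_has_type_jeq.eq_trans)
next
  case (eq_conv \<Gamma> a b A B i)
  show ?case
    using eq_conv.IH(1)[OF eq_conv.prems] eq_conv.IH(2)[OF eq_conv.prems]
    by (auto intro: wf_ctx_has_type_jeq.eq_conv)
next
  case (eq_pi \<Gamma> A i A' B B' j)
  show ?case
    using eq_pi.IH(1)[OF eq_pi.prems] eq_pi.IH(2)[OF eq_pi.prems]
      eq_pi.IH(3)[OF ctx_insert.there[OF eq_pi.prems]]
    by (auto intro: wf_ctx_has_type_jeq.eq_pi)
next
  case (eq_lam \<Gamma> A i A' b b' B)
  show ?case
    using eq_lam.IH(1)[OF eq_lam.prems] eq_lam.IH(2)[OF eq_lam.prems]
      eq_lam.IH(3)[OF ctx_insert.there[OF eq_lam.prems]]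
    by (auto intro: wf_ctx_has_type_jeq.eq_lam)
next
  case (eq_app \<Gamma> f f' A B a a')
  show ?case
    using eq_app.IH(1)[OF eq_app.prems] eq_app.IH(2)[OF eq_app.prems]
    by (auto simp: lift_subst_ge intro: wf_ctx_has_type_jeq.eq_app)
next
  case (eq_beta \<Gamma> A i b B a)
  show ?case
    using eq_beta.IH(1)[OF eq_beta.prems] eq_beta.IH(2)[OF ctx_insert.there[OF eq_beta.prems]]
      eq_beta.IH(3)[OF eq_beta.prems]
    by (auto simp: lift_subst_ge intro: wf_ctx_has_type_jeq.eq_beta)
next
  case (eq_eta \<Gamma> f A B)
  then show ?case
    using wf_ctx_has_type_jeq.eq_eta[of \<Gamma>' "lift f k" "lift A k" "lift B (Suc k)"]
    by (simp add: lift_lift)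
next
  case (eq_comp \<Gamma> R)
  then show ?case by (simp add: computation_closed wf_ctx_has_type_jeq.eq_comp)
qed (auto intro: wf_ctx_has_type_jeq.ty_univ wf_ctx_has_type_jeq.ty_const
    wf_ctx_has_type_jeq.eq_refl wf_ctx_has_type_jeq.eq_sym)

lemma weaken_typing: "\<Gamma> \<turnstile> a : A \<Longrightarrow> \<Gamma> \<turnstile> X : Univ i \<Longrightarrow> X # \<Gamma> \<turnstile> lift a 0 : lift A 0"
  by (blast intro: weaken_typing_at ctx_insert.here)

lemma weaken_univ: "\<Gamma> \<turnstile> A : Univ j \<Longrightarrow> \<Gamma> \<turnstile> X : Univ i \<Longrightarrow> X # \<Gamma> \<turnstile> lift A 0 : Univ j"
  using weaken_typing[of \<Gamma> A "Univ j"] by simp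

section \<open>Admissibility of substitution for a variable at any depth\<close>

inductive ctx_subst :: "nat \<Rightarrow> tm \<Rightarrow> tm list \<Rightarrow> tm list \<Rightarrow> bool" where
  here: "\<Gamma> \<turnstile> s : A \<Longrightarrow> ctx_subst 0 s (A # \<Gamma>) \<Gamma>"
| there: "ctx_subst k s \<Gamma> \<Gamma>' \<Longrightarrow> ctx_subst (Suc k) (lift s 0) (A # \<Gamma>) (subst A s k # \<Gamma>')"

inductive_cases ctx_consE: "\<turnstile> A # \<Gamma>"

text \<open>Below further declarations, the typing obtained for the smaller context is weakened by
  the new head. Weakening thus has to precede substitution, and
  \<open>\<turnstile> \<Gamma>'\<close> is assumed in order to know that this head is a
  type.\<close>

lemma ctx_subst_var:
  assumes "ctx_subst k s \<Gamma> \<Gamma>'" "\<turnstile> \<Gamma>'" "n < length \<Gamma>"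
  shows "\<Gamma>' \<turnstile> subst (Var n) s k : subst (((\<lambda>A. lift A 0) ^^ Suc n) (\<Gamma> ! n)) s k"
  using assms
proof (induction arbitrary: n)
  case (here \<Gamma> s A)
  then show ?case by (cases n) (auto intro: ty_var[where n = "n - 1", simplified] dest: ty_var)
next
  case (there k s \<Gamma> \<Gamma>' A)
  from there.prems(1) obtain i where A: "\<Gamma>' \<turnstile> subst A s k : Univ i" and \<Gamma>': "\<turnstile> \<Gamma>'"
    by (rule ctx_consE)
  show ?case
  proof (cases n)
    case 0
    then show ?thesis using ty_var[OF there.prems(1), of 0] by (simp add: lift_subst_le)
  next
    case (Suc m)
    then have "\<Gamma>' \<turnstile> subst (Var m) s k : subst (((\<lambda>A. lift A 0) ^^ Suc m) (\<Gamma> ! m)) s k"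
      using there \<Gamma>' by simp
    from weaken_typing[OF this A] show ?thesis
      using Suc by (auto simp: lift_subst_le split: if_splits)
  qed
qed

text \<open>The same simultaneous induction as for weakening. The substituted term is generalized
  along with the depth, since it is lifted at every binder that is crossed.\<close>

lemma
  shows subst_ctx: "\<turnstile> \<Gamma> \<Longrightarrow> ctx_subst k s \<Gamma> \<Gamma>' \<Longrightarrow> \<turnstile> \<Gamma>'"
    and subst_typing_at: "\<Gamma> \<turnstile> a : A \<Longrightarrow> ctx_subst k s \<Gamma> \<Gamma>' \<Longrightarrow> \<Gamma>' \<turnstile> subst a s k : subst A s k"
    and subst_eq_at: "\<Gamma> \<turnstile> a \<equiv> b : A \<Longrightarrow> ctx_subst k s \<Gamma> \<Gamma>' \<Longrightarrow>
      \<Gamma>' \<turnstile> subst a s k \<equiv> subst b s k : subst A s k"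
proof (induction arbitrary: k s \<Gamma>' and k s \<Gamma>' and k s \<Gamma>' rule: wf_ctx_has_type_jeq.inducts)
  case ctx_empty
  then show ?case by cases
next
  case (ctx_ext \<Gamma> A i)
  from ctx_ext.prems show ?case
  proof cases
    case here
    then show ?thesis
      using ctx_ext.hyps by (auto intro: wf_ctx_has_type_jeq.ctx_ext)
  next
    case there
    with ctx_ext.IH show ?thesis
      by (metis wf_ctx_has_type_jeq.ctx_ext lift.simps(2) subst.simps(2))
  qed
next
  case (ty_var \<Gamma> n)
  then show ?case by (blast intro: ctx_subst_var)
next
  case (ty_pi \<Gamma> A i B j)
  show ?case
    using ty_pi.IH(1)[OF ty_pi.prems] ty_pi.IH(2)[OF ctx_subst.there[OF ty_pi.prems]]
    by (simp add: wf_ctx_has_type_jeq.ty_pi)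
next
  case (ty_lam \<Gamma> A i b B)
  show ?case
    using ty_lam.IH(1)[OF ty_lam.prems] ty_lam.IH(2)[OF ctx_subst.there[OF ty_lam.prems]]
    by (auto intro: wf_ctx_has_type_jeq.ty_lam)
next
  case (ty_app \<Gamma> f A B a)
  show ?case
    using ty_app.IH(1)[OF ty_app.prems] ty_app.IH(2)[OF ty_app.prems]
    by (auto simp: subst_subst intro: wf_ctx_has_type_jeq.ty_app)
next
  case (ty_conv \<Gamma> a A B i)
  show ?case
    using ty_conv.IH(1)[OF ty_conv.prems] ty_conv.IH(2)[OF ty_conv.prems]
    by (auto intro: wf_ctx_has_type_jeq.ty_conv)
next
  case (eq_trans \<Gamma> a b A c)
  show ?case
    using eq_trans.IH(1)[OF eq_trans.prems] eq_trans.IH(2)[OF eq_trans.prems]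
    by (auto intro: wf_ctx_has_type_jeq.eq_trans)
next
  case (eq_conv \<Gamma> a b A B i)
  show ?case
    using eq_conv.IH(1)[OF eq_conv.prems] eq_conv.IH(2)[OF eq_conv.prems]
    by (auto intro: wf_ctx_has_type_jeq.eq_conv)
next
  case (eq_pi \<Gamma> A i A' B B' j)
  show ?case
    using eq_pi.IH(1)[OF eq_pi.prems] eq_pi.IH(2)[OF eq_pi.prems]
      eq_pi.IH(3)[OF ctx_subst.there[OF eq_pi.prems]]
    by (auto intro: wf_ctx_has_type_jeq.eq_pi)
next
  case (eq_lam \<Gamma> A i A' b b' B)
  show ?case
    using eq_lam.IH(1)[OF eq_lam.prems] eq_lam.IH(2)[OF eq_lam.prems]
      eq_lam.IH(3)[OF ctx_subst.there[OF eq_lam.prems]]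
    by (auto intro: wf_ctx_has_type_jeq.eq_lam)
next
  case (eq_app \<Gamma> f f' A B a a')
  show ?case
    using eq_app.IH(1)[OF eq_app.prems] eq_app.IH(2)[OF eq_app.prems]
    by (auto simp: subst_subst intro: wf_ctx_has_type_jeq.eq_app)
next
  case (eq_beta \<Gamma> A i b B a)
  show ?case
    using eq_beta.IH(1)[OF eq_beta.prems] eq_beta.IH(2)[OF ctx_subst.there[OF eq_beta.prems]]
      eq_beta.IH(3)[OF eq_beta.prems]
    by (auto simp: subst_subst intro: wf_ctx_has_type_jeq.eq_beta)
next
  case (eq_eta \<Gamma> f A B)
  then show ?case
    using wf_ctx_has_type_jeq.eq_eta[of \<Gamma>' "subst f s k" "subst A s k" "subst B (lift s 0) (Suc k)"]
    by (simp add: lift_subst_le)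
next
  case (eq_comp \<Gamma> R)
  then show ?case by (simp add: computation_closed wf_ctx_has_type_jeq.eq_comp)
qed (auto intro: wf_ctx_has_type_jeq.ty_univ wf_ctx_has_type_jeq.ty_const
    wf_ctx_has_type_jeq.eq_refl wf_ctx_has_type_jeq.eq_sym)

lemma subst_typing: "A # \<Gamma> \<turnstile> b : B \<Longrightarrow> \<Gamma> \<turnstile> a : A \<Longrightarrow> \<Gamma> \<turnstile> subst b a 0 : subst B a 0"
  by (blast intro: subst_typing_at ctx_subst.here)


section \<open>Dependent sums\<close>

lemma weaken_under_binder:
  "Y # \<Gamma> \<turnstile> a : A \<Longrightarrow> \<Gamma> \<turnstile> X : Univ i \<Longrightarrow> lift Y 0 # X # \<Gamma> \<turnstile> lift a (Suc 0) : lift A (Suc 0)"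
  by (blast intro: weaken_typing_at ctx_insert.intros)

text \<open>A weakened abstraction applied to a fresh variable beta-reduces to a term of this form
  (with \<open>k = 0\<close>); the identity turns it back into the original body.\<close>

lemma subst_lift_var [simp]: "subst (lift t (Suc k)) (Var k) k = t"
  by (induction t arbitrary: k) auto

lemma lift_lift_simp [simp]: "lift (lift t 0) (Suc k) = lift (lift t k) 0"
  by (simp add: lift_lift)

lemma subst_lift_lift [simp]: "subst (lift t 0) (lift s 0) (Suc k) = lift (subst t s k) 0"
  by (simp add: lift_subst_le)

text \<open>Apply both sides to a fresh variable.\<close>

lemma lam_injective:
  assumes "\<Gamma> \<turnstile> Lam T l \<equiv> Lam T r : Pi T C" "\<Gamma> \<turnstile> T : Univ i" "T # \<Gamma> \<turnstile> l : C" "T # \<Gamma> \<turnstile> r : C"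
  shows "T # \<Gamma> \<turnstile> l \<equiv> r : C"
proof -
  have var: "T # \<Gamma> \<turnstile> Var 0 : lift T 0"
    using ty_var[OF ctx_of_typing[OF assms(3)], of 0] by simp
  have T: "T # \<Gamma> \<turnstile> lift T 0 : Univ i"
    using assms(2) by (rule weaken_univ) fact
  have beta: "T # \<Gamma> \<turnstile> App (Lam (lift T 0) (lift b (Suc 0))) (Var 0) \<equiv> b : C" if "T # \<Gamma> \<turnstile> b : C" for b
    using eq_beta[OF T weaken_under_binder[OF that assms(2)] var] by simp
  have "T # \<Gamma> \<turnstile> lift (Lam T l) 0 \<equiv> lift (Lam T r) 0 : lift (Pi T C) 0"
    using weaken_eq_at[OF assms(1) ctx_insert.here[OF assms(2)]] .
  from eq_app[OF this[simplified] eq_refl[OF var]]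
  have "T # \<Gamma> \<turnstile> App (Lam (lift T 0) (lift l (Suc 0))) (Var 0) \<equiv>
      App (Lam (lift T 0) (lift r (Suc 0))) (Var 0) : C"
    by simp
  with beta[OF assms(3)] beta[OF assms(4)] show ?thesis
    by (blast intro: eq_trans eq_sym)
qed

text \<open>
  The suffix \<open>F\<close> marks variants whose family is an opaque term \<open>F : A \<rightarrow> Univ j\<close> instead of a body
  \<open>B\<close> under a binder, so that lifting and substitution meet no binders.
\<close>

definition SigF :: "nat \<Rightarrow> nat \<Rightarrow> tm \<Rightarrow> tm \<Rightarrow> tm" where
  "SigF i j A F = App (App (Const (SigT i j)) A) F"

definition PairF :: "nat \<Rightarrow> nat \<Rightarrow> tm \<Rightarrow> tm \<Rightarrow> tm \<Rightarrow> tm \<Rightarrow> tm" where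
  "PairF i j A F a b = App (App (App (App (Const (PairC i j)) A) F) a) b"

definition SigIndF :: "nat \<Rightarrow> nat \<Rightarrow> nat \<Rightarrow> tm \<Rightarrow> tm \<Rightarrow> tm \<Rightarrow> tm \<Rightarrow> tm \<Rightarrow> tm" where
  "SigIndF i j k A F C g z = App (App (App (App (App (Const (SigInd i j k)) A) F) C) g) z"

lemma SigF_simps [simp]:
  "lift (SigF i j A F) n = SigF i j (lift A n) (lift F n)"
  "subst (SigF i j A F) s n = SigF i j (subst A s n) (subst F s n)"
  by (simp_all add: SigF_def)

lemma PairF_simps [simp]:
  "lift (PairF i j A F a b) n = PairF i j (lift A n) (lift F n) (lift a n) (lift b n)"
  "subst (PairF i j A F a b) s n =
    PairF i j (subst A s n) (subst F s n) (subst a s n) (subst b s n)"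
  by (simp_all add: PairF_def)

lemma SigIndF_simps [simp]:
  "lift (SigIndF i j k A F C g z) n =
    SigIndF i j k (lift A n) (lift F n) (lift C n) (lift g n) (lift z n)"
  "subst (SigIndF i j k A F C g z) s n =
    SigIndF i j k (subst A s n) (subst F s n) (subst C s n) (subst g s n) (subst z s n)"
  by (simp_all add: SigIndF_def)

lemma ty_sigF:
  assumes "\<Gamma> \<turnstile> A : Univ i" "\<Gamma> \<turnstile> F : Pi A (Univ j)"
  shows "\<Gamma> \<turnstile> SigF i j A F : Univ (max i j)"
proof -
  have "\<Gamma> \<turnstile> Const (SigT i j) : Pi (Univ i) (Pi (Pi (Var 0) (Univ j)) (Univ (max i j)))"
    using ty_const[OF ctx_of_typing[OF assms(1)], of "SigT i j"] by (simp add: expr_simps)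
  from ty_app[OF ty_app[OF this assms(1), simplified] assms(2)] show ?thesis
    by (simp add: SigF_def)
qed

lemma ty_pairF:
  assumes "\<Gamma> \<turnstile> A : Univ i" "\<Gamma> \<turnstile> F : Pi A (Univ j)" "\<Gamma> \<turnstile> a : A" "\<Gamma> \<turnstile> b : App F a"
  shows "\<Gamma> \<turnstile> PairF i j A F a b : SigF i j A F"
proof -
  have "\<Gamma> \<turnstile> Const (PairC i j) : Pi (Univ i) (Pi (Pi (Var 0) (Univ j)) (Pi (Var 1)
      (Pi (App (Var 1) (Var 0)) (SigF i j (Var 3) (Var 2)))))"
    using ty_const[OF ctx_of_typing[OF assms(1)], of "PairC i j"]
    by (simp add: expr_simps SigF_def numeral_3_eq_3 numeral_2_eq_2)
  from ty_app[OF this assms(1)]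
  have "\<Gamma> \<turnstile> App (Const (PairC i j)) A : Pi (Pi A (Univ j)) (Pi (lift A 0)
      (Pi (App (Var 1) (Var 0)) (SigF i j (lift (lift (lift A 0) 0) 0) (Var 2))))"
    by simp
  from ty_app[OF this assms(2)]
  have "\<Gamma> \<turnstile> App (App (Const (PairC i j)) A) F :
      Pi A (Pi (App (lift F 0) (Var 0)) (SigF i j (lift (lift A 0) 0) (lift (lift F 0) 0)))"
    by (simp add: numeral_2_eq_2)
  from ty_app[OF this assms(3)]
  have "\<Gamma> \<turnstile> App (App (App (Const (PairC i j)) A) F) a : Pi (App F a) (SigF i j (lift A 0) (lift F 0))"
    by simp
  from ty_app[OF this assms(4)] show ?thesis
    by (simp add: PairF_def)
qed

text \<open>The curried premise of sum induction. Indices 1 and 0 are the two components of the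
  pair, so the parameters are weakened past two binders.\<close>

abbreviation branch_type :: "nat \<Rightarrow> nat \<Rightarrow> tm \<Rightarrow> tm \<Rightarrow> tm \<Rightarrow> tm" where
  "branch_type i j A F C \<equiv> Pi A (Pi (App (lift F 0) (Var 0)) (App (lift (lift C 0) 0)
    (PairF i j (lift (lift A 0) 0) (lift (lift F 0) 0) (Var (Suc 0)) (Var 0))))"

text \<open>The eliminator is left without its last argument so that one derivation serves both its
  typing and its congruence in that argument.\<close>

lemma ty_sigIndF_fun:
  assumes "\<Gamma> \<turnstile> A : Univ i" "\<Gamma> \<turnstile> F : Pi A (Univ j)" "\<Gamma> \<turnstile> C : Pi (SigF i j A F) (Univ k)"
    "\<Gamma> \<turnstile> g : branch_type i j A F C"
  shows "\<Gamma> \<turnstile> App (App (App (App (Const (SigInd i j k)) A) F) C) g :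
    Pi (SigF i j A F) (App (lift C 0) (Var 0))"
proof -
  have "\<Gamma> \<turnstile> Const (SigInd i j k) : Pi (Univ i) (Pi (Pi (Var 0) (Univ j))
      (Pi (Pi (SigF i j (Var 1) (Var 0)) (Univ k))
      (Pi (branch_type i j (Var 2) (Var 1) (Var 0))
      (Pi (SigF i j (Var 3) (Var 2)) (App (Var 2) (Var 0))))))"
    using ty_const[OF ctx_of_typing[OF assms(1)], of "SigInd i j k"]
    by (simp add: expr_simps SigF_def PairF_def numeral_eq_Suc)
  from ty_app[OF this assms(1)]
  have "\<Gamma> \<turnstile> App (Const (SigInd i j k)) A : Pi (Pi A (Univ j))
      (Pi (Pi (SigF i j (lift A 0) (Var 0)) (Univ k))
      (Pi (branch_type i j (lift (lift A 0) 0) (Var 1) (Var 0))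
      (Pi (SigF i j (lift (lift (lift A 0) 0) 0) (Var 2)) (App (Var 2) (Var 0)))))"
    by (simp add: numeral_eq_Suc)
  from ty_app[OF this assms(2)]
  have "\<Gamma> \<turnstile> App (App (Const (SigInd i j k)) A) F :
      Pi (Pi (SigF i j A F) (Univ k))
      (Pi (branch_type i j (lift A 0) (lift F 0) (Var 0))
      (Pi (SigF i j (lift (lift A 0) 0) (lift (lift F 0) 0)) (App (Var 2) (Var 0))))"
    by (simp add: numeral_eq_Suc)
  from ty_app[OF this assms(3)]
  have "\<Gamma> \<turnstile> App (App (App (Const (SigInd i j k)) A) F) C : Pi (branch_type i j A F C)
      (Pi (SigF i j (lift A 0) (lift F 0)) (App (lift (lift C 0) 0) (Var 0)))"
    by (simp add: numeral_eq_Suc)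
  from ty_app[OF this assms(4)]
  show ?thesis by simp
qed

lemma ty_sigIndF:
  assumes "\<Gamma> \<turnstile> A : Univ i" "\<Gamma> \<turnstile> F : Pi A (Univ j)" "\<Gamma> \<turnstile> C : Pi (SigF i j A F) (Univ k)"
    "\<Gamma> \<turnstile> g : branch_type i j A F C" "\<Gamma> \<turnstile> z : SigF i j A F"
  shows "\<Gamma> \<turnstile> SigIndF i j k A F C g z : App C z"
  using ty_app[OF ty_sigIndF_fun[OF assms(1-4)] assms(5)] by (simp add: SigIndF_def)

lemma eq_sigIndF_cong:
  assumes "\<Gamma> \<turnstile> A : Univ i" "\<Gamma> \<turnstile> F : Pi A (Univ j)" "\<Gamma> \<turnstile> C : Pi (SigF i j A F) (Univ k)"
    "\<Gamma> \<turnstile> g : branch_type i j A F C" "\<Gamma> \<turnstile> z \<equiv> z' : SigF i j A F"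
  shows "\<Gamma> \<turnstile> SigIndF i j k A F C g z \<equiv> SigIndF i j k A F C g z' : App C z"
  using eq_app[OF eq_refl[OF ty_sigIndF_fun[OF assms(1-4)]] assms(5)] by (simp add: SigIndF_def)

text \<open>The rule \<open>pair\<close> equates two sixfold abstractions. Injectivity of
  abstraction opens it to an equality in the context of its telescope, where the actual parameters
  can be substituted for the variables.\<close>

lemma eq_sigIndF:
  assumes "\<Gamma> \<turnstile> A : Univ i" "\<Gamma> \<turnstile> F : Pi A (Univ j)" "\<Gamma> \<turnstile> C : Pi (SigF i j A F) (Univ k)"
    "\<Gamma> \<turnstile> g : branch_type i j A F C" "\<Gamma> \<turnstile> a : A" "\<Gamma> \<turnstile> b : App F a"
  shows "\<Gamma> \<turnstile> SigIndF i j k A F C g (PairF i j A F a b) \<equiv> App (App g a) b : App C (PairF i j A F a b)"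
proof -
  \<comment> \<open>the telescope of the computation rule\<close>
  define T1 where "T1 = Univ i"
  define T2 where "T2 = Pi (Var 0) (Univ j)"
  define T3 where "T3 = Pi (SigF i j (Var 1) (Var 0)) (Univ k)"
  define T4 where "T4 = branch_type i j (Var 2) (Var 1) (Var 0)"
  define T5 where "T5 = Var 3"
  define T6 where "T6 = App (Var 3) (Var 0)"
  note T = T1_def T2_def T3_def T4_def T5_def T6_def
  define p where "p = PairF i j (Var 5) (Var 4) (Var 1) (Var 0)"
  define l where "l = SigIndF i j k (Var 5) (Var 4) (Var 3) (Var 2) p"
  define r where "r = App (App (Var 2) (Var 1)) (Var 0)"
  have w0: "\<turnstile> \<Gamma>" using assms(1) by (rule ctx_of_typing)
  \<comment> \<open>Removing an abstraction requires its domain to be a type and both bodies to be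
    typed, so the whole telescope is checked entry by entry.\<close>
  have 1: "\<Gamma> \<turnstile> T1 : Univ (Suc i)" using w0 by (simp add: T1_def ty_univ)
  have w1: "\<turnstile> [T1] @ \<Gamma>" using ctx_ext[OF w0 1] by simp
  have A1: "[T1] @ \<Gamma> \<turnstile> Var 0 : Univ i" using ty_var[OF w1, of 0] by (simp add: T)
  have 2: "[T1] @ \<Gamma> \<turnstile> T2 : Univ (max i (Suc j))"
    unfolding T2_def by (intro ty_pi A1 ty_univ ctx_ext[OF w1 A1])
  have w2: "\<turnstile> [T2, T1] @ \<Gamma>" using ctx_ext[OF w1 2] by simp
  have A2: "[T2, T1] @ \<Gamma> \<turnstile> Var 1 : Univ i" using ty_var[OF w2, of 1] by (simp add: T)
  have F2: "[T2, T1] @ \<Gamma> \<turnstile> Var 0 : Pi (Var 1) (Univ j)"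
    using ty_var[OF w2, of 0] by (simp add: T)
  have 3: "[T2, T1] @ \<Gamma> \<turnstile> T3 : Univ (max (max i j) (Suc k))"
    unfolding T3_def using ty_sigF[OF A2 F2] by (intro ty_pi ty_univ ctx_ext[OF w2])
  have w3: "\<turnstile> [T3, T2, T1] @ \<Gamma>" using ctx_ext[OF w2 3] by simp
  have A3: "[T3, T2, T1] @ \<Gamma> \<turnstile> Var 2 : Univ i"
    using ty_var[OF w3, of 2] by (simp add: T numeral_eq_Suc)
  have F3: "[T3, T2, T1] @ \<Gamma> \<turnstile> Var 1 : Pi (Var 2) (Univ j)"
    using ty_var[OF w3, of 1] by (simp add: T numeral_eq_Suc)
  have C3: "[T3, T2, T1] @ \<Gamma> \<turnstile> Var 0 : Pi (SigF i j (Var 2) (Var 1)) (Univ k)"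
    using ty_var[OF w3, of 0] by (simp add: T numeral_eq_Suc)
  \<comment> \<open>\<open>T4\<close> is itself a double product. The two extra declarations here
    are its bound variables: \<open>Var 2\<close> is the type \<open>A\<close> of the first
    component, and the next one is the fibre over it.\<close>
  have w3a: "\<turnstile> [Var 2, T3, T2, T1] @ \<Gamma>" using ctx_ext[OF w3 A3] by simp
  have A3a: "[Var 2, T3, T2, T1] @ \<Gamma> \<turnstile> Var 3 : Univ i"
    using ty_var[OF w3a, of 3] by (simp add: T numeral_eq_Suc)
  have F3a: "[Var 2, T3, T2, T1] @ \<Gamma> \<turnstile> Var 2 : Pi (Var 3) (Univ j)"
    using ty_var[OF w3a, of 2] by (simp add: T numeral_eq_Suc)
  have a3a: "[Var 2, T3, T2, T1] @ \<Gamma> \<turnstile> Var 0 : Var 3"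
    using ty_var[OF w3a, of 0] by (simp add: T numeral_eq_Suc)
  have Fa3a: "[Var 2, T3, T2, T1] @ \<Gamma> \<turnstile> App (Var 2) (Var 0) : Univ j"
    using ty_app[OF F3a a3a] by simp
  have w3b: "\<turnstile> [App (Var 2) (Var 0), Var 2, T3, T2, T1] @ \<Gamma>" using ctx_ext[OF w3a Fa3a] by simp
  note v = ty_var[OF w3b]
  let ?\<Delta> = "[App (Var 2) (Var 0), Var 2, T3, T2, T1] @ \<Gamma>"
  have "?\<Delta> \<turnstile> PairF i j (Var 4) (Var 3) (Var 1) (Var 0) : SigF i j (Var 4) (Var 3)"
    using v[of 4] v[of 3] v[of 1] v[of 0] by (intro ty_pairF) (simp_all add: T numeral_eq_Suc)
  moreover have "?\<Delta> \<turnstile> Var 2 : Pi (SigF i j (Var 4) (Var 3)) (Univ k)"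
    using v[of 2] by (simp add: T numeral_eq_Suc)
  ultimately have "?\<Delta> \<turnstile> App (Var 2) (PairF i j (Var 4) (Var 3) (Var 1) (Var 0)) : Univ k"
    using ty_app by fastforce
  then have 4: "[T3, T2, T1] @ \<Gamma> \<turnstile> T4 : Univ (max i (max j k))"
    unfolding T4_def using A3 Fa3a by (intro ty_pi) (simp_all add: numeral_eq_Suc)
  have w4: "\<turnstile> [T4, T3, T2, T1] @ \<Gamma>" using ctx_ext[OF w3 4] by simp
  have 5: "[T4, T3, T2, T1] @ \<Gamma> \<turnstile> T5 : Univ i"
    using ty_var[OF w4, of 3] by (simp add: T numeral_eq_Suc)
  have w5: "\<turnstile> [T5, T4, T3, T2, T1] @ \<Gamma>" using ctx_ext[OF w4 5] by simp
  have F5: "[T5, T4, T3, T2, T1] @ \<Gamma> \<turnstile> Var 3 : Pi (Var 4) (Univ j)"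
    using ty_var[OF w5, of 3] by (simp add: T numeral_eq_Suc)
  have a5: "[T5, T4, T3, T2, T1] @ \<Gamma> \<turnstile> Var 0 : Var 4"
    using ty_var[OF w5, of 0] by (simp add: T numeral_eq_Suc)
  have 6: "[T5, T4, T3, T2, T1] @ \<Gamma> \<turnstile> T6 : Univ j" using ty_app[OF F5 a5] by (simp add: T)
  have w6: "\<turnstile> [T6, T5, T4, T3, T2, T1] @ \<Gamma>" using ctx_ext[OF w5 6] by simp
  note v = ty_var[OF w6]
  let ?\<Delta> = "[T6, T5, T4, T3, T2, T1] @ \<Gamma>"
  have p: "?\<Delta> \<turnstile> p : SigF i j (Var 5) (Var 4)"
    unfolding p_def using v[of 5] v[of 4] v[of 1] v[of 0]
    by (intro ty_pairF) (simp_all add: T numeral_eq_Suc)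
  have l: "?\<Delta> \<turnstile> l : App (Var 3) p"
    unfolding l_def using v[of 5] v[of 4] v[of 3] v[of 2] p
    by (intro ty_sigIndF) (simp_all add: T numeral_eq_Suc)
  have g: "?\<Delta> \<turnstile> Var 2 : branch_type i j (Var 5) (Var 4) (Var 3)"
    using v[of 2] by (simp add: T numeral_eq_Suc)
  have a: "?\<Delta> \<turnstile> Var 1 : Var 5" "?\<Delta> \<turnstile> Var 0 : App (Var 4) (Var 1)"
    using v[of 1] v[of 0] by (simp_all add: T numeral_eq_Suc)
  have r: "?\<Delta> \<turnstile> r : App (Var 3) p"
    using ty_app[OF ty_app[OF g a(1), simplified]] a(2)
    by (simp add: r_def p_def numeral_eq_Suc)
  have "\<Gamma> \<turnstile> Lam T1 (Lam T2 (Lam T3 (Lam T4 (Lam T5 (Lam T6 l))))) \<equiv>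
      Lam T1 (Lam T2 (Lam T3 (Lam T4 (Lam T5 (Lam T6 r))))) :
      Pi T1 (Pi T2 (Pi T3 (Pi T4 (Pi T5 (Pi T6 (App (Var 3) p))))))"
    using eq_comp[OF w0 computation.pair[of i j k]]
    by (simp add: lhs_def rhs_def type_of_def expr_simps T l_def r_def p_def SigF_def PairF_def
        SigIndF_def numeral_eq_Suc)
  \<comment> \<open>The six abstractions are now stripped from the outside, each moving its domain
    into the context.\<close>
  from \<open>\<Gamma> \<turnstile> Lam T1 _ \<equiv> _ : _\<close>
  have "T1 # \<Gamma> \<turnstile> Lam T2 (Lam T3 (Lam T4 (Lam T5 (Lam T6 l)))) \<equiv>
      Lam T2 (Lam T3 (Lam T4 (Lam T5 (Lam T6 r)))) :
      Pi T2 (Pi T3 (Pi T4 (Pi T5 (Pi T6 (App (Var 3) p)))))"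
    by (rule lam_injective) (use 1 2 3 4 5 6 l r in \<open>auto intro!: ty_lam\<close>)
  then have "[T2, T1] @ \<Gamma> \<turnstile> Lam T3 (Lam T4 (Lam T5 (Lam T6 l))) \<equiv>
      Lam T3 (Lam T4 (Lam T5 (Lam T6 r))) : Pi T3 (Pi T4 (Pi T5 (Pi T6 (App (Var 3) p))))"
    unfolding append_Cons append_Nil
    by (rule lam_injective) (use 1 2 3 4 5 6 l r in \<open>auto intro!: ty_lam\<close>)
  then have "[T3, T2, T1] @ \<Gamma> \<turnstile> Lam T4 (Lam T5 (Lam T6 l)) \<equiv>
      Lam T4 (Lam T5 (Lam T6 r)) : Pi T4 (Pi T5 (Pi T6 (App (Var 3) p)))"
    unfolding append_Cons append_Nil
    by (rule lam_injective) (use 1 2 3 4 5 6 l r in \<open>auto intro!: ty_lam\<close>)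
  then have "[T4, T3, T2, T1] @ \<Gamma> \<turnstile> Lam T5 (Lam T6 l) \<equiv> Lam T5 (Lam T6 r) : Pi T5 (Pi T6 (App (Var 3) p))"
    unfolding append_Cons append_Nil
    by (rule lam_injective) (use 1 2 3 4 5 6 l r in \<open>auto intro!: ty_lam\<close>)
  then have "[T5, T4, T3, T2, T1] @ \<Gamma> \<turnstile> Lam T6 l \<equiv> Lam T6 r : Pi T6 (App (Var 3) p)"
    unfolding append_Cons append_Nil
    by (rule lam_injective) (use 1 2 3 4 5 6 l r in \<open>auto intro!: ty_lam\<close>)
  then have "[T6, T5, T4, T3, T2, T1] @ \<Gamma> \<turnstile> l \<equiv> r : App (Var 3) p"
    unfolding append_Cons append_Nil
    by (rule lam_injective) (use 1 2 3 4 5 6 l r in \<open>auto intro!: ty_lam\<close>)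
  \<comment> \<open>The parameters \<open>A\<close>, \<open>F\<close>, \<open>C\<close>,
    \<open>g\<close>, \<open>a\<close>, \<open>b\<close> replace the variables from the outermost
    inwards, so the depth of the substitution falls from 5 to 0. The typings of the later parameters
    are kept as premises until the end.\<close>
  note subst_eq_at[OF this[unfolded append_Cons append_Nil] ctx_subst.there[OF ctx_subst.there[OF ctx_subst.there[OF
    ctx_subst.there[OF ctx_subst.there[OF ctx_subst.here[OF assms(1)[folded T1_def]]]]]]]]
  note subst_eq_at[OF this ctx_subst.there[OF ctx_subst.there[OF ctx_subst.there[OF
    ctx_subst.there[OF ctx_subst.here]]]], of F]
  note subst_eq_at[OF this ctx_subst.there[OF ctx_subst.there[OF ctx_subst.there[OF
    ctx_subst.here]]], of C]
  note subst_eq_at[OF this ctx_subst.there[OF ctx_subst.there[OF ctx_subst.here]], of g]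
  note subst_eq_at[OF this ctx_subst.there[OF ctx_subst.here], of a]
  note subst_eq_at[OF this ctx_subst.here, of b]
  from this show ?thesis
    using assms by (simp add: T l_def r_def p_def numeral_eq_Suc)
qed

section \<open>Sums whose family is a body under a binder\<close>

lemma ty_pi': "\<Gamma> \<turnstile> A : Univ i \<Longrightarrow> A # \<Gamma> \<turnstile> B : Univ j \<Longrightarrow> k = max i j \<Longrightarrow> \<Gamma> \<turnstile> Pi A B : Univ k"
  by (simp add: ty_pi)

lemma ty_var0: "\<Gamma> \<turnstile> A : Univ i \<Longrightarrow> A # \<Gamma> \<turnstile> Var 0 : lift A 0"
  using ty_var[of "A # \<Gamma>" 0] by (auto intro: ctx_ext ctx_of_typing)

lemma ty_var1:
  "\<Gamma> \<turnstile> A : Univ i \<Longrightarrow> A # \<Gamma> \<turnstile> B : Univ j \<Longrightarrow> B # A # \<Gamma> \<turnstile> Var (Suc 0) : lift (lift A 0) 0"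
  using weaken_typing[OF ty_var0] by simp

lemma ty_app':
  assumes "\<Gamma> \<turnstile> f : Pi A B" "\<Gamma> \<turnstile> a : A" "T = subst B a 0"
  shows "\<Gamma> \<turnstile> App f a : T"
  using assms ty_app by simp

text \<open>The judgments have congruence only for their term formers. Abstracting the family
  reduces the claim to congruence of application, and beta on both sides removes the
  redexes.\<close>

lemma eq_subst:
  assumes "\<Gamma> \<turnstile> A : Univ i" "A # \<Gamma> \<turnstile> B : Univ j" "\<Gamma> \<turnstile> a \<equiv> a' : A" "\<Gamma> \<turnstile> a : A" "\<Gamma> \<turnstile> a' : A"
  shows "\<Gamma> \<turnstile> subst B a 0 \<equiv> subst B a' 0 : Univ j"
proof -
  have "\<Gamma> \<turnstile> App (Lam A B) a \<equiv> App (Lam A B) a' : Univ j"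
    using eq_app[OF eq_refl[OF ty_lam[OF assms(1,2)]] assms(3)] by simp
  moreover have "\<Gamma> \<turnstile> App (Lam A B) c \<equiv> subst B c 0 : Univ j" if "\<Gamma> \<turnstile> c : A" for c
    using eq_beta[OF assms(1,2) that] by simp
  ultimately show ?thesis
    using assms(4,5) by (blast intro: eq_trans eq_sym)
qed

lemma lift_lift_Suc: "lift (lift t (Suc 0)) (Suc (Suc k)) = lift (lift t (Suc k)) (Suc 0)"
  by (simp add: lift_lift)

lemma subst_lift_lift_var [simp]: "subst (lift (lift B (Suc 0)) (Suc 0)) (Var (Suc 0)) 0 = lift B 0"
  using lift_subst_ge[of 0 0 "lift B (Suc 0)" "Var 0"] by simp

text \<open>Evaluates at \<open>a\<close> a motive that is \<open>B\<close> taken at a term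
  \<open>s\<close> depending on the scrutinee, as in the second projection.\<close>

lemma subst_subst_lift [simp]: "subst (subst (lift B (Suc 0)) s 0) a 0 = subst B (subst s a 0) 0"
  using subst_subst[of 0 0 "lift B (Suc 0)" s a] by simp

definition Sig :: "nat \<Rightarrow> nat \<Rightarrow> tm \<Rightarrow> tm \<Rightarrow> tm" where
  "Sig i j A B = SigF i j A (Lam A B)"

definition Pair :: "nat \<Rightarrow> nat \<Rightarrow> tm \<Rightarrow> tm \<Rightarrow> tm \<Rightarrow> tm \<Rightarrow> tm" where
  "Pair i j A B a b = PairF i j A (Lam A B) a b"

text \<open>Elimination into the constant motive \<open>A\<close>. It is the raw form of
  \<open>pr1\<close>, with which it has to agree syntactically in the final theorem.\<close>

definition Pr1 :: "nat \<Rightarrow> nat \<Rightarrow> tm \<Rightarrow> tm \<Rightarrow> tm \<Rightarrow> tm" where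
  "Pr1 i j A B z =
    SigIndF i j i A (Lam A B) (Lam (Sig i j A B) (lift A 0)) (Lam A (Lam B (Var (Suc 0)))) z"

lemma Sig_simps [simp]:
  "lift (Sig i j A B) n = Sig i j (lift A n) (lift B (Suc n))"
  "subst (Sig i j A B) s n = Sig i j (subst A s n) (subst B (lift s 0) (Suc n))"
  by (simp_all add: Sig_def)

lemma Pair_simps [simp]:
  "lift (Pair i j A B a b) n = Pair i j (lift A n) (lift B (Suc n)) (lift a n) (lift b n)"
  "subst (Pair i j A B a b) s n =
    Pair i j (subst A s n) (subst B (lift s 0) (Suc n)) (subst a s n) (subst b s n)"
  by (simp_all add: Pair_def)

lemma Pr1_simps [simp]:
  "lift (Pr1 i j A B z) n = Pr1 i j (lift A n) (lift B (Suc n)) (lift z n)"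
  "subst (Pr1 i j A B z) s n = Pr1 i j (subst A s n) (subst B (lift s 0) (Suc n)) (subst z s n)"
  by (simp_all add: Pr1_def)

lemma ty_sig:
  assumes "\<Gamma> \<turnstile> A : Univ i" "A # \<Gamma> \<turnstile> B : Univ j" "k = max i j"
  shows "\<Gamma> \<turnstile> Sig i j A B : Univ k"
  unfolding Sig_def using assms by (auto intro!: ty_sigF ty_lam)

lemma ty_pair:
  assumes "\<Gamma> \<turnstile> A : Univ i" "A # \<Gamma> \<turnstile> B : Univ j" "\<Gamma> \<turnstile> a : A" "\<Gamma> \<turnstile> b : subst B a 0"
  shows "\<Gamma> \<turnstile> Pair i j A B a b : Sig i j A B"
  unfolding Sig_def Pair_def
proof (rule ty_pairF[OF assms(1) ty_lam[OF assms(1,2)] assms(3)])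
  show "\<Gamma> \<turnstile> b : App (Lam A B) a"
    using eq_beta[OF assms(1,2,3)] by (auto intro: ty_conv[OF assms(4)] eq_sym)
qed

context
  fixes \<Gamma> A B i j
  assumes A: "\<Gamma> \<turnstile> A : Univ i" and B: "A # \<Gamma> \<turnstile> B : Univ j"
begin

text \<open>\<open>branch_type\<close> mentions the family and the motive as applied abstractions,
  while a branch is naturally typed by their reduced forms. The two product types are equal by beta,
  in the domain of the second component and in the codomain.\<close>

lemma ty_branch:
  assumes C: "Sig i j A B # \<Gamma> \<turnstile> C : Univ k"
    and g: "B # A # \<Gamma> \<turnstile> g : subst (lift (lift C (Suc 0)) (Suc 0)) (Pair i j (lift (lift A 0) 0)
      (lift (lift B (Suc 0)) (Suc 0)) (Var (Suc 0)) (Var 0)) 0"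
  shows "\<Gamma> \<turnstile> Lam A (Lam B g) : branch_type i j A (Lam A B) (Lam (Sig i j A B) C)"
proof -
  let ?S = "Sig i j A B" and ?\<Delta> = "B # A # \<Gamma>"
  let ?A = "lift (lift A 0) 0" and ?B = "lift (lift B (Suc 0)) (Suc 0)"
  let ?p = "Pair i j ?A ?B (Var (Suc 0)) (Var 0)"
  have A2: "?\<Delta> \<turnstile> ?A : Univ i"
    by (intro weaken_univ[OF weaken_univ[OF A A] B])
  have B2: "?A # ?\<Delta> \<turnstile> ?B : Univ j"
    using weaken_under_binder[OF weaken_under_binder[OF B A] B] by simp
  have S: "\<Gamma> \<turnstile> ?S : Univ (max i j)"
    by (rule ty_sig[OF A B HOL.refl])
  have S2: "?\<Delta> \<turnstile> Sig i j ?A ?B : Univ (max i j)"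
    by (rule ty_sig[OF A2 B2 HOL.refl])
  have C2: "Sig i j ?A ?B # ?\<Delta> \<turnstile> lift (lift C (Suc 0)) (Suc 0) : Univ k"
    using weaken_under_binder[OF weaken_under_binder[OF C A] B] by simp
  have p: "?\<Delta> \<turnstile> ?p : Sig i j ?A ?B"
    using ty_var1[OF A B] ty_var0[OF B] by (intro ty_pair A2 B2) simp_all
  have eqC: "?\<Delta> \<turnstile> subst (lift (lift C (Suc 0)) (Suc 0)) ?p 0 \<equiv>
      App (Lam (Sig i j ?A ?B) (lift (lift C (Suc 0)) (Suc 0))) ?p : Univ k"
    using eq_sym[OF eq_beta[OF S2 C2 p]] by simp
  have eqB: "A # \<Gamma> \<turnstile> B \<equiv> App (Lam (lift A 0) (lift B (Suc 0))) (Var 0) : Univ j"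
    using eq_sym[OF eq_beta[OF weaken_univ[OF A A] weaken_under_binder[OF B A, simplified] ty_var0[OF A]]]
    by simp
  from eq_pi[OF A eq_refl[OF A] eq_pi[OF B eqB eqC]]
  have "\<Gamma> \<turnstile> Pi A (Pi B (subst (lift (lift C (Suc 0)) (Suc 0)) ?p 0)) \<equiv>
      branch_type i j A (Lam A B) (Lam ?S C) : Univ (max i (max j k))"
    by (simp add: Pair_def Sig_def)
  with ty_lam[OF A ty_lam[OF B g]] show ?thesis
    by (rule ty_conv)
qed

lemma ty_pr1_branch:
  "\<Gamma> \<turnstile> Lam A (Lam B (Var (Suc 0))) : branch_type i j A (Lam A B) (Lam (Sig i j A B) (lift A 0))"
  using ty_var1[OF A B]
  by (intro ty_branch[of _ i] weaken_univ[OF A ty_sig[OF A B HOL.refl]]) simp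

lemma ty_pr1:
  assumes "\<Gamma> \<turnstile> z : Sig i j A B"
  shows "\<Gamma> \<turnstile> Pr1 i j A B z : A"
proof -
  have S: "\<Gamma> \<turnstile> Sig i j A B : Univ (max i j)" by (rule ty_sig[OF A B HOL.refl])
  have "\<Gamma> \<turnstile> Pr1 i j A B z : App (Lam (Sig i j A B) (lift A 0)) z"
    unfolding Pr1_def using ty_pr1_branch assms
    by (intro ty_sigIndF[OF A ty_lam[OF A B]]) (auto simp: Sig_def[symmetric] intro: ty_lam S weaken_univ A)
  with eq_beta[OF S weaken_univ[OF A S] assms] show ?thesis
    by (auto intro: ty_conv)
qed

lemma eq_pr1:
  assumes "\<Gamma> \<turnstile> z : Sig i j A B" "\<Gamma> \<turnstile> z \<equiv> z' : Sig i j A B"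
  shows "\<Gamma> \<turnstile> Pr1 i j A B z \<equiv> Pr1 i j A B z' : A"
proof -
  have S: "\<Gamma> \<turnstile> Sig i j A B : Univ (max i j)" by (rule ty_sig[OF A B HOL.refl])
  have "\<Gamma> \<turnstile> Pr1 i j A B z \<equiv> Pr1 i j A B z' : App (Lam (Sig i j A B) (lift A 0)) z"
    unfolding Pr1_def using ty_pr1_branch assms(2)
    by (intro eq_sigIndF_cong[OF A ty_lam[OF A B]]) (auto simp: Sig_def[symmetric] intro: ty_lam S weaken_univ A)
  with eq_beta[OF S weaken_univ[OF A S] assms(1)] show ?thesis
    by (auto intro: eq_conv)
qed

text \<open>The computation rule of sums gives the branch applied to both components, and two beta
  steps then reduce that application to the first one.\<close>

lemma eq_pr1_pair:
  assumes a: "\<Gamma> \<turnstile> a : A" and b: "\<Gamma> \<turnstile> b : subst B a 0"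
  shows "\<Gamma> \<turnstile> Pr1 i j A B (Pair i j A B a b) \<equiv> a : A"
proof -
  let ?S = "Sig i j A B" and ?p = "Pair i j A B a b"
  have S: "\<Gamma> \<turnstile> ?S : Univ (max i j)" by (rule ty_sig[OF A B HOL.refl])
  \<comment> \<open>The computation rule yields its equality at the motive applied to the pair; this
    conversion moves it to \<open>A\<close>.\<close>
  have conv: "\<Gamma> \<turnstile> App (Lam ?S (lift A 0)) ?p \<equiv> A : Univ i"
    using eq_beta[OF S weaken_univ[OF A S] ty_pair[OF A B a b]] by simp
  have b': "\<Gamma> \<turnstile> b : App (Lam A B) a"
    using eq_beta[OF A B a] by (auto intro: ty_conv[OF b] eq_sym)
  have "\<Gamma> \<turnstile> Pr1 i j A B ?p \<equiv> App (App (Lam A (Lam B (Var (Suc 0)))) a) b : App (Lam ?S (lift A 0)) ?p"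
    unfolding Pr1_def Pair_def using ty_pr1_branch a b'
    by (intro eq_sigIndF[OF A ty_lam[OF A B]]) (auto simp: Sig_def[symmetric] intro: ty_lam S weaken_univ A)
  then have 1: "\<Gamma> \<turnstile> Pr1 i j A B ?p \<equiv> App (App (Lam A (Lam B (Var (Suc 0)))) a) b : A"
    using conv by (rule eq_conv)
  have "\<Gamma> \<turnstile> App (Lam A (Lam B (Var (Suc 0)))) a \<equiv> Lam (subst B a 0) (lift a 0) : Pi (subst B a 0) (lift A 0)"
    using eq_beta[OF A ty_lam[OF B ty_var1[OF A B]] a] by simp
  from eq_app[OF this eq_refl[OF b]]
  have 2: "\<Gamma> \<turnstile> App (App (Lam A (Lam B (Var (Suc 0)))) a) b \<equiv> App (Lam (subst B a 0) (lift a 0)) b : A"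
    by simp
  have Ba: "\<Gamma> \<turnstile> subst B a 0 : Univ j" using subst_typing[OF B a] by simp
  have 3: "\<Gamma> \<turnstile> App (Lam (subst B a 0) (lift a 0)) b \<equiv> a : A"
    using eq_beta[OF Ba weaken_typing[OF a Ba] b] by simp
  from 1 2 3 show ?thesis by (blast intro: eq_trans)
qed

end

text \<open>Sum induction with the motive sending \<open>z\<close> to \<open>B\<close> at the first
  projection of \<open>z\<close>. Existence suffices because the types in the theorem mention first
  projections only.\<close>

lemma ex_pr2:
  assumes A: "\<Gamma> \<turnstile> A : Univ i" and B: "A # \<Gamma> \<turnstile> B : Univ j" and z: "\<Gamma> \<turnstile> z : Sig i j A B"
  shows "\<exists>b. \<Gamma> \<turnstile> b : subst B (Pr1 i j A B z) 0"
proof -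
  let ?S = "Sig i j A B"
  let ?C = "subst (lift B (Suc 0)) (Pr1 i j (lift A 0) (lift B (Suc 0)) (Var 0)) 0"
  have S: "\<Gamma> \<turnstile> ?S : Univ (max i j)" by (rule ty_sig[OF A B HOL.refl])
  have A1: "?S # \<Gamma> \<turnstile> lift A 0 : Univ i" by (rule weaken_univ[OF A S])
  have B1: "lift A 0 # ?S # \<Gamma> \<turnstile> lift B (Suc 0) : Univ j"
    using weaken_under_binder[OF B S] by simp
  have "?S # \<Gamma> \<turnstile> Pr1 i j (lift A 0) (lift B (Suc 0)) (Var 0) : lift A 0"
    using ty_var0[OF S] by (intro ty_pr1 A1 B1) simp
  from subst_typing[OF B1 this] have C: "?S # \<Gamma> \<turnstile> ?C : Univ j" by simp
  let ?\<Delta> = "B # A # \<Gamma>"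
  let ?A = "lift (lift A 0) 0" and ?B = "lift (lift B (Suc 0)) (Suc 0)"
  let ?p = "Pair i j ?A ?B (Var (Suc 0)) (Var 0)"
  have A2: "?\<Delta> \<turnstile> ?A : Univ i"
    by (intro weaken_univ[OF weaken_univ[OF A A] B])
  have B2: "?A # ?\<Delta> \<turnstile> ?B : Univ j"
    using weaken_under_binder[OF weaken_under_binder[OF B A] B] by simp
  have v: "?\<Delta> \<turnstile> Var (Suc 0) : ?A" "?\<Delta> \<turnstile> Var 0 : subst ?B (Var (Suc 0)) 0"
    using ty_var1[OF A B] ty_var0[OF B] by simp_all
  \<comment> \<open>The second variable has type \<open>B\<close> at the first variable, but the
    motive at the pair asks for \<open>B\<close> at the projection of that pair;
    \<open>eq_pr1_pair\<close> identifies the two indices.\<close>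
  have "?\<Delta> \<turnstile> subst ?B (Var (Suc 0)) 0 \<equiv> subst ?B (Pr1 i j ?A ?B ?p) 0 : Univ j"
    by (intro eq_subst[OF A2 B2] eq_sym[OF eq_pr1_pair] A2 B2 v ty_pr1 ty_pair)
  then have g: "?\<Delta> \<turnstile> Var 0 : subst ?B (Pr1 i j ?A ?B ?p) 0"
    by (rule ty_conv[OF v(2)])
  have "subst (lift (lift ?C (Suc 0)) (Suc 0)) ?p 0 = subst ?B (Pr1 i j ?A ?B ?p) 0"
    by (simp add: lift_subst_ge lift_lift_Suc)
  with g have "\<Gamma> \<turnstile> Lam A (Lam B (Var 0)) : branch_type i j A (Lam A B) (Lam ?S ?C)"
    by (intro ty_branch[OF A B C]) simp
  then have "\<Gamma> \<turnstile> SigIndF i j j A (Lam A B) (Lam ?S ?C) (Lam A (Lam B (Var 0))) z : App (Lam ?S ?C) z"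
    using z
    by (intro ty_sigIndF[OF A ty_lam[OF A B]]) (auto simp: Sig_def[symmetric] intro: ty_lam S C)
  moreover have "\<Gamma> \<turnstile> App (Lam ?S ?C) z \<equiv> subst B (Pr1 i j A B z) 0 : Univ j"
    using eq_beta[OF S C z] by simp
  ultimately show ?thesis by (blast intro: ty_conv)
qed


section \<open>Identity types, propositions and the unit type\<close>

lemma subst_lift_lift_Suc [simp]: "subst (lift (lift t 0) 0) s (Suc 0) = lift t 0"
  using subst_lift[of "lift t 0" "Suc 0" s] by (simp del: subst_lift)

definition Idt :: "nat \<Rightarrow> tm \<Rightarrow> tm \<Rightarrow> tm \<Rightarrow> tm" where
  "Idt i A x y = App (App (App (Const (IdT i)) A) x) y"

definition IsProp :: "nat \<Rightarrow> tm \<Rightarrow> tm" where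
  "IsProp i A = Pi A (Pi (lift A 0) (Idt i (lift (lift A 0) 0) (Var (Suc 0)) (Var 0)))"

abbreviation Unit :: "nat \<Rightarrow> tm" where
  "Unit i \<equiv> Const (UnitT i)"

lemma Idt_simps [simp]:
  "lift (Idt i A x y) n = Idt i (lift A n) (lift x n) (lift y n)"
  "subst (Idt i A x y) s n = Idt i (subst A s n) (subst x s n) (subst y s n)"
  by (simp_all add: Idt_def)

lemma IsProp_simps [simp]:
  "lift (IsProp i A) n = IsProp i (lift A n)"
  "subst (IsProp i A) s n = IsProp i (subst A s n)"
  by (simp_all add: IsProp_def)

lemma ty_idt:
  assumes "\<Gamma> \<turnstile> A : Univ i" "\<Gamma> \<turnstile> x : A" "\<Gamma> \<turnstile> y : A"
  shows "\<Gamma> \<turnstile> Idt i A x y : Univ i"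
proof -
  have "\<Gamma> \<turnstile> Const (IdT i) : Pi (Univ i) (Pi (Var 0) (Pi (Var 1) (Univ i)))"
    using ty_const[OF ctx_of_typing[OF assms(1)], of "IdT i"] by (simp add: expr_simps)
  from ty_app[OF ty_app[OF ty_app[OF this assms(1), simplified] assms(2), simplified] assms(3)]
  show ?thesis by (simp add: Idt_def)
qed

lemma ty_refl:
  assumes "\<Gamma> \<turnstile> A : Univ i" "\<Gamma> \<turnstile> x : A"
  shows "\<Gamma> \<turnstile> App (App (Const (Refl i)) A) x : Idt i A x x"
proof -
  have "\<Gamma> \<turnstile> Const (Refl i) : Pi (Univ i) (Pi (Var 0) (Idt i (Var 1) (Var 0) (Var 0)))"
    using ty_const[OF ctx_of_typing[OF assms(1)], of "Refl i"] by (simp add: expr_simps Idt_def)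
  from ty_app[OF ty_app[OF this assms(1), simplified] assms(2)] show ?thesis by simp
qed

lemma ty_isProp:
  assumes "\<Gamma> \<turnstile> A : Univ i"
  shows "\<Gamma> \<turnstile> IsProp i A : Univ i"
  unfolding IsProp_def
proof (rule ty_pi'[OF assms ty_pi])
  note A1 = weaken_univ[OF assms assms]
  show "A # \<Gamma> \<turnstile> lift A 0 : Univ i" by (rule A1)
  show "lift A 0 # A # \<Gamma> \<turnstile> Idt i (lift (lift A 0) 0) (Var (Suc 0)) (Var 0) : Univ i"
    by (intro ty_idt weaken_univ[OF A1 A1] ty_var1[OF assms A1] ty_var0[OF A1])
qed simp

lemma ty_isProp_app:
  assumes "\<Gamma> \<turnstile> h : IsProp i A" "\<Gamma> \<turnstile> x : A" "\<Gamma> \<turnstile> y : A"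
  shows "\<Gamma> \<turnstile> App (App h x) y : Idt i A x y"
  using ty_app[OF ty_app[OF assms(1)[unfolded IsProp_def] assms(2), simplified] assms(3)]
  by simp

lemma ty_unit: "\<turnstile> \<Gamma> \<Longrightarrow> \<Gamma> \<turnstile> Unit i : Univ i"
  using ty_const[of \<Gamma> "UnitT i"] by (simp add: expr_simps)

lemma ty_star: "\<turnstile> \<Gamma> \<Longrightarrow> \<Gamma> \<turnstile> Const (Star i) : Unit i"
  using ty_const[of \<Gamma> "Star i"] by (simp add: expr_simps)

text \<open>The eliminator is applied to the abstraction of \<open>C\<close>; beta removes this
  redex at the point and, under the product, at a variable.\<close>

lemma unit_induct:
  assumes C: "Unit i # \<Gamma> \<turnstile> C : Univ k" and c: "\<Gamma> \<turnstile> c : subst C (Const (Star i)) 0"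
  shows "\<exists>h. \<Gamma> \<turnstile> h : Pi (Unit i) C"
proof -
  have w: "\<turnstile> \<Gamma>" using c by (rule ctx_of_typing)
  note U = ty_unit[OF w, of i]
  define F where "F = Lam (Unit i) C"
  have F: "\<Gamma> \<turnstile> F : Pi (Unit i) (Univ k)"
    unfolding F_def by (rule ty_lam[OF U C])
  have "\<Gamma> \<turnstile> Const (UnitInd i k) : Pi (Pi (Unit i) (Univ k)) (Pi (App (Var 0) (Const (Star i)))
      (Pi (Unit i) (App (Var 2) (Var 0))))"
    using ty_const[OF w, of "UnitInd i k"] by (simp add: expr_simps numeral_eq_Suc)
  from ty_app[OF this F]
  have f: "\<Gamma> \<turnstile> App (Const (UnitInd i k)) F :
      Pi (App F (Const (Star i))) (Pi (Unit i) (App (lift (lift F 0) 0) (Var 0)))"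
    by (simp add: numeral_eq_Suc)
  have "\<Gamma> \<turnstile> App F (Const (Star i)) \<equiv> subst C (Const (Star i)) 0 : Univ k"
    using eq_beta[OF U C ty_star[OF w]] by (simp add: F_def)
  from ty_app[OF f ty_conv[OF c eq_sym[OF this]]]
  have h: "\<Gamma> \<turnstile> App (App (Const (UnitInd i k)) F) c : Pi (Unit i) (App (lift F 0) (Var 0))"
    by simp
  have "Unit i # \<Gamma> \<turnstile> App (lift F 0) (Var 0) \<equiv> C : Univ k"
    using eq_beta[OF weaken_univ[OF U U] weaken_under_binder[OF C U] ty_var0[OF U]]
    by (simp add: F_def)
  then have "\<Gamma> \<turnstile> Pi (Unit i) (App (lift F 0) (Var 0)) \<equiv> Pi (Unit i) C : Univ (max i k)"
    using U by (blast intro: eq_pi eq_refl)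
  with h show ?thesis by (blast intro: ty_conv)
qed

text \<open>Induction on both arguments reduces the claim to reflexivity at the point. The induction
  on the second argument is done first, with the point as first argument.\<close>

lemma unit_is_prop:
  assumes w: "\<turnstile> \<Gamma>"
  shows "\<exists>h. \<Gamma> \<turnstile> h : IsProp i (Unit i)"
proof -
  note U = ty_unit[OF w, of i]
  have U1: "Unit i # \<Gamma> \<turnstile> Unit i : Univ i"
    using weaken_univ[OF U U] by simp
  have U2: "Unit i # Unit i # \<Gamma> \<turnstile> Unit i : Univ i"
    using weaken_univ[OF U1 U1] by simp
  have C: "Unit i # Unit i # \<Gamma> \<turnstile> Idt i (Unit i) (Var (Suc 0)) (Var 0) : Univ i"
    using ty_var1[OF U U1] ty_var0[OF U1] by (intro ty_idt U2) simp_all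
  have D: "Unit i # \<Gamma> \<turnstile> Idt i (Unit i) (Const (Star i)) (Var 0) : Univ i"
    using ty_var0[OF U] by (intro ty_idt U1 ty_star ctx_of_typing[OF U1]) simp
  obtain d where "\<Gamma> \<turnstile> d : Pi (Unit i) (Idt i (Unit i) (Const (Star i)) (Var 0))"
    using unit_induct[OF D] ty_refl[OF U ty_star[OF w]] by auto
  \<comment> \<open>The type of \<open>d\<close> is recognized as the motive of the outer induction
    evaluated at the point.\<close>
  then have "\<Gamma> \<turnstile> d : subst (Pi (Unit i) (Idt i (Unit i) (Var (Suc 0)) (Var 0))) (Const (Star i)) 0"
    by simp
  from unit_induct[OF ty_pi[OF U1 C] this] show ?thesis
    by (simp add: IsProp_def)
qed


section \<open>Equivalences and smallness\<close>

definition SectionT :: "nat \<Rightarrow> nat \<Rightarrow> tm \<Rightarrow> tm \<Rightarrow> tm \<Rightarrow> tm" where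
  "SectionT i j A B f = Sig (max i j) j (Pi B (lift A 0))
    (Pi (lift B 0) (Idt j (lift (lift B 0) 0)
      (App (lift (lift f 0) 0) (App (Var (Suc 0)) (Var 0))) (Var 0)))"

definition RetractionT :: "nat \<Rightarrow> nat \<Rightarrow> tm \<Rightarrow> tm \<Rightarrow> tm \<Rightarrow> tm" where
  "RetractionT i j A B f = Sig (max i j) i (Pi B (lift A 0))
    (Pi (lift A 0) (Idt i (lift (lift A 0) 0)
      (App (Var (Suc 0)) (App (lift (lift f 0) 0) (Var 0))) (Var 0)))"

definition IsEquiv :: "nat \<Rightarrow> nat \<Rightarrow> tm \<Rightarrow> tm \<Rightarrow> tm \<Rightarrow> tm" where
  "IsEquiv i j A B f =
    Sig (max i j) (max i j) (SectionT i j A B f) (lift (RetractionT i j A B f) 0)"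

definition EquivT :: "nat \<Rightarrow> nat \<Rightarrow> tm \<Rightarrow> tm \<Rightarrow> tm" where
  "EquivT i j A B =
    Sig (max i j) (max i j) (Pi A (lift B 0)) (IsEquiv i j (lift A 0) (lift B 0) (Var 0))"

definition Small :: "nat \<Rightarrow> nat \<Rightarrow> tm \<Rightarrow> tm" where
  "Small u v X = Sig (Suc v) (max v u) (Univ v) (EquivT v u (Var 0) (lift X 0))"

lemma equiv_simps [simp]:
  "lift (SectionT i j A B f) n = SectionT i j (lift A n) (lift B n) (lift f n)"
  "subst (SectionT i j A B f) s n = SectionT i j (subst A s n) (subst B s n) (subst f s n)"
  "lift (RetractionT i j A B f) n = RetractionT i j (lift A n) (lift B n) (lift f n)"
  "subst (RetractionT i j A B f) s n = RetractionT i j (subst A s n) (subst B s n) (subst f s n)"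
  "lift (IsEquiv i j A B f) n = IsEquiv i j (lift A n) (lift B n) (lift f n)"
  "subst (IsEquiv i j A B f) s n = IsEquiv i j (subst A s n) (subst B s n) (subst f s n)"
  "lift (EquivT i j A B) n = EquivT i j (lift A n) (lift B n)"
  "subst (EquivT i j A B) s n = EquivT i j (subst A s n) (subst B s n)"
  by (simp_all add: SectionT_def RetractionT_def IsEquiv_def EquivT_def)

context
  fixes \<Gamma> i j A B
  assumes A: "\<Gamma> \<turnstile> A : Univ i" and B: "\<Gamma> \<turnstile> B : Univ j"
begin

lemma ty_arrow: "\<Gamma> \<turnstile> Pi B (lift A 0) : Univ (max i j)"
  by (rule ty_pi'[OF B weaken_univ[OF A B]]) simp

lemma ty_section_body:
  assumes f: "\<Gamma> \<turnstile> f : Pi A (lift B 0)"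
  shows "Pi B (lift A 0) # \<Gamma> \<turnstile> Pi (lift B 0) (Idt j (lift (lift B 0) 0)
      (App (lift (lift f 0) 0) (App (Var (Suc 0)) (Var 0))) (Var 0)) : Univ j"
proof (rule ty_pi'[of _ _ j _ j])
  let ?K = "Pi B (lift A 0)"
  show B1: "?K # \<Gamma> \<turnstile> lift B 0 : Univ j" by (rule weaken_univ[OF B ty_arrow])
  let ?\<Delta> = "lift B 0 # ?K # \<Gamma>"
  have g: "?\<Delta> \<turnstile> Var (Suc 0) : Pi (lift (lift B 0) 0) (lift (lift (lift A 0) 0) 0)"
    using ty_var1[OF ty_arrow B1] by simp
  have f2: "?\<Delta> \<turnstile> lift (lift f 0) 0 : Pi (lift (lift A 0) 0) (lift (lift (lift B 0) 0) 0)"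
    using weaken_typing[OF weaken_typing[OF f ty_arrow] B1] by simp
  show "?\<Delta> \<turnstile> Idt j (lift (lift B 0) 0) (App (lift (lift f 0) 0) (App (Var (Suc 0)) (Var 0))) (Var 0) : Univ j"
    by (intro ty_idt weaken_univ[OF B1 B1] ty_var0[OF B1] ty_app'[OF f2] ty_app'[OF g]) simp_all
qed simp

lemma ty_retraction_body:
  assumes f: "\<Gamma> \<turnstile> f : Pi A (lift B 0)"
  shows "Pi B (lift A 0) # \<Gamma> \<turnstile> Pi (lift A 0) (Idt i (lift (lift A 0) 0)
      (App (Var (Suc 0)) (App (lift (lift f 0) 0) (Var 0))) (Var 0)) : Univ i"
proof (rule ty_pi'[of _ _ i _ i])
  let ?K = "Pi B (lift A 0)"
  show A1: "?K # \<Gamma> \<turnstile> lift A 0 : Univ i" by (rule weaken_univ[OF A ty_arrow])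
  let ?\<Delta> = "lift A 0 # ?K # \<Gamma>"
  have g: "?\<Delta> \<turnstile> Var (Suc 0) : Pi (lift (lift B 0) 0) (lift (lift (lift A 0) 0) 0)"
    using ty_var1[OF ty_arrow A1] by simp
  have f2: "?\<Delta> \<turnstile> lift (lift f 0) 0 : Pi (lift (lift A 0) 0) (lift (lift (lift B 0) 0) 0)"
    using weaken_typing[OF weaken_typing[OF f ty_arrow] A1] by simp
  show "?\<Delta> \<turnstile> Idt i (lift (lift A 0) 0) (App (Var (Suc 0)) (App (lift (lift f 0) 0) (Var 0))) (Var 0) : Univ i"
    by (intro ty_idt weaken_univ[OF A1 A1] ty_var0[OF A1] ty_app'[OF g] ty_app'[OF f2]) simp_all
qed simp

lemma ty_section: "\<Gamma> \<turnstile> f : Pi A (lift B 0) \<Longrightarrow> \<Gamma> \<turnstile> SectionT i j A B f : Univ (max i j)"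
  unfolding SectionT_def by (intro ty_sig[OF ty_arrow ty_section_body]) simp_all

lemma ty_retraction: "\<Gamma> \<turnstile> f : Pi A (lift B 0) \<Longrightarrow> \<Gamma> \<turnstile> RetractionT i j A B f : Univ (max i j)"
  unfolding RetractionT_def by (intro ty_sig[OF ty_arrow ty_retraction_body]) simp_all

lemma ty_retraction1:
  "\<Gamma> \<turnstile> f : Pi A (lift B 0) \<Longrightarrow>
    SectionT i j A B f # \<Gamma> \<turnstile> lift (RetractionT i j A B f) 0 : Univ (max i j)"
  by (rule weaken_univ[OF ty_retraction ty_section])

lemma ty_isEquiv: "\<Gamma> \<turnstile> f : Pi A (lift B 0) \<Longrightarrow> \<Gamma> \<turnstile> IsEquiv i j A B f : Univ (max i j)"
  unfolding IsEquiv_def by (rule ty_sig[OF ty_section ty_retraction1]) simp_all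

end

lemma ty_isEquiv_body:
  assumes A: "\<Gamma> \<turnstile> A : Univ i" and B: "\<Gamma> \<turnstile> B : Univ j"
  shows "Pi A (lift B 0) # \<Gamma> \<turnstile> IsEquiv i j (lift A 0) (lift B 0) (Var 0) : Univ (max i j)"
  using ty_var0[OF ty_arrow[OF B A]]
  by (intro ty_isEquiv weaken_univ[OF _ ty_arrow[OF B A]] A B) simp

lemma ty_equivT:
  assumes A: "\<Gamma> \<turnstile> A : Univ i" and B: "\<Gamma> \<turnstile> B : Univ j"
  shows "\<Gamma> \<turnstile> EquivT i j A B : Univ (max i j)"
  unfolding EquivT_def using ty_arrow[OF B A]
  by (intro ty_sig ty_isEquiv_body A B) (simp_all add: max.commute)

text \<open>The map \<open>g\<close> serves both as section and as retraction: the required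
  identities hold because \<open>B\<close> and \<open>A\<close> have at most one element.\<close>

lemma props_equiv:
  assumes A: "\<Gamma> \<turnstile> A : Univ i" and B: "\<Gamma> \<turnstile> B : Univ j"
    and hA: "\<Gamma> \<turnstile> hA : IsProp i A" and hB: "\<Gamma> \<turnstile> hB : IsProp j B"
    and f: "\<Gamma> \<turnstile> f : Pi A (lift B 0)" and g: "\<Gamma> \<turnstile> g : Pi B (lift A 0)"
  shows "\<exists>e. \<Gamma> \<turnstile> e : EquivT i j A B"
proof -
  note wA = weaken_typing[OF _ A] and wB = weaken_typing[OF _ B]
  have "\<Gamma> \<turnstile> Lam B (App (App (lift hB 0) (App (lift f 0) (App (lift g 0) (Var 0)))) (Var 0)) :
      Pi B (Idt j (lift B 0) (App (lift f 0) (App (lift g 0) (Var 0))) (Var 0))"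
    using wB[OF hB] wB[OF f] wB[OF g] ty_var0[OF B]
    by (intro ty_lam[OF B] ty_isProp_app) (auto intro!: ty_app')
  then obtain s where s: "\<Gamma> \<turnstile> s : SectionT i j A B f"
    using ty_pair[OF ty_arrow[OF A B] ty_section_body[OF A B f] g] by (auto simp: SectionT_def)
  have "\<Gamma> \<turnstile> Lam A (App (App (lift hA 0) (App (lift g 0) (App (lift f 0) (Var 0)))) (Var 0)) :
      Pi A (Idt i (lift A 0) (App (lift g 0) (App (lift f 0) (Var 0))) (Var 0))"
    using wA[OF hA] wA[OF f] wA[OF g] ty_var0[OF A]
    by (intro ty_lam[OF A] ty_isProp_app) (auto intro!: ty_app')
  then obtain r where r: "\<Gamma> \<turnstile> r : RetractionT i j A B f"
    using ty_pair[OF ty_arrow[OF A B] ty_retraction_body[OF A B f] g]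
    by (auto simp: RetractionT_def)
  obtain d where d: "\<Gamma> \<turnstile> d : IsEquiv i j A B f"
    using ty_pair[OF ty_section[OF A B f] ty_retraction1[OF A B f] s] r
    by (auto simp: IsEquiv_def simp del: equiv_simps)
  have "\<Gamma> \<turnstile> Pi A (lift B 0) : Univ (max i j)"
    using ty_arrow[OF B A] by (simp add: max.commute)
  from ty_pair[OF this ty_isEquiv_body[OF A B] f] d show ?thesis
    by (auto simp: EquivT_def)
qed

text \<open>\<open>Q\<close> itself is the small copy, which is why the equivalence runs from
  \<open>Q\<close> to \<open>P\<close>.\<close>

lemma prop_small:
  assumes P: "\<Gamma> \<turnstile> P : Univ u" and Q: "\<Gamma> \<turnstile> Q : Univ v"
    and hP: "\<Gamma> \<turnstile> hP : IsProp u P" and hQ: "\<Gamma> \<turnstile> hQ : IsProp v Q"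
    and f: "\<Gamma> \<turnstile> f : Pi Q (lift P 0)" and g: "\<Gamma> \<turnstile> g : Pi P (lift Q 0)"
  shows "\<exists>e. \<Gamma> \<turnstile> e : Small u v P"
proof -
  have U: "\<Gamma> \<turnstile> Univ v : Univ (Suc v)"
    by (rule ty_univ[OF ctx_of_typing[OF P]])
  have "Univ v # \<Gamma> \<turnstile> EquivT v u (Var 0) (lift P 0) : Univ (max v u)"
    using ty_var0[OF U] by (intro ty_equivT weaken_univ[OF P U]) simp
  from ty_pair[OF U this Q] props_equiv[OF Q P hQ hP f g] show ?thesis
    by (auto simp: Small_def)
qed


section \<open>The lifting\<close>

definition OmegaT :: "nat \<Rightarrow> tm" where
  "OmegaT v = Sig (Suc v) v (Univ v) (IsProp v (Var 0))"

definition Holds :: "nat \<Rightarrow> tm \<Rightarrow> tm" where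
  "Holds v q = Pr1 (Suc v) v (Univ v) (IsProp v (Var 0)) q"

definition LiftT :: "nat \<Rightarrow> nat \<Rightarrow> tm \<Rightarrow> tm" where
  "LiftT u v P = Sig (Suc v) (max v u) (OmegaT v) (Pi (Holds v (Var 0)) (lift (lift P 0) 0))"

definition LiftProp :: "nat \<Rightarrow> nat \<Rightarrow> tm \<Rightarrow> tm \<Rightarrow> tm" where
  "LiftProp u v P x =
    Pr1 (Suc v) (max v u) (OmegaT v) (Pi (Holds v (Var 0)) (lift (lift P 0) 0)) x"

definition LiftLe :: "nat \<Rightarrow> nat \<Rightarrow> tm \<Rightarrow> tm \<Rightarrow> tm \<Rightarrow> tm" where
  "LiftLe u v P x y = Pi (Holds v (LiftProp u v P x)) (lift (Holds v (LiftProp u v P y)) 0)"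

definition UpperBound :: "nat \<Rightarrow> nat \<Rightarrow> nat \<Rightarrow> tm \<Rightarrow> tm \<Rightarrow> tm \<Rightarrow> tm" where
  "UpperBound u v t P S y = Pi (LiftT u v P) (Pi (Holds t (App (lift S 0) (Var 0)))
    (LiftLe u v (lift (lift P 0) 0) (Var (Suc 0)) (lift (lift y 0) 0)))"

definition Least :: "nat \<Rightarrow> nat \<Rightarrow> nat \<Rightarrow> tm \<Rightarrow> tm \<Rightarrow> tm \<Rightarrow> tm" where
  "Least u v t P S y = Pi (LiftT u v P) (Pi (UpperBound u v t (lift P 0) (lift S 0) (Var 0))
    (LiftLe u v (lift (lift P 0) 0) (lift (lift y 0) 0) (Var (Suc 0))))"

text \<open>The product of the two conditions is a sum over a constant family, hence the weakening
  of \<open>Least\<close>.\<close>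

definition IsSup :: "nat \<Rightarrow> nat \<Rightarrow> nat \<Rightarrow> tm \<Rightarrow> tm \<Rightarrow> tm \<Rightarrow> tm" where
  "IsSup u v t P S y = Sig (sup_lev u v t) (sup_lev u v t) (UpperBound u v t P S y)
    (lift (Least u v t P S y) 0)"

definition HasSups :: "nat \<Rightarrow> nat \<Rightarrow> nat \<Rightarrow> tm \<Rightarrow> tm" where
  "HasSups u v t P = Pi (Pi (LiftT u v P) (OmegaT t))
    (Sig (lev u v) (sup_lev u v t) (LiftT u v (lift P 0))
      (IsSup u v t (lift (lift P 0) 0) (Var (Suc 0)) (Var 0)))"

lemma OmegaT_simps [simp]: "lift (OmegaT v) n = OmegaT v" "subst (OmegaT v) s n = OmegaT v"
  by (simp_all add: OmegaT_def)

lemma Holds_simps [simp]: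
  "lift (Holds v q) n = Holds v (lift q n)" "subst (Holds v q) s n = Holds v (subst q s n)"
  by (simp_all add: Holds_def)

lemma lifting_simps [simp]:
  "lift (LiftT u v P) n = LiftT u v (lift P n)"
  "subst (LiftT u v P) s n = LiftT u v (subst P s n)"
  "lift (LiftProp u v P x) n = LiftProp u v (lift P n) (lift x n)"
  "subst (LiftProp u v P x) s n = LiftProp u v (subst P s n) (subst x s n)"
  "lift (LiftLe u v P x y) n = LiftLe u v (lift P n) (lift x n) (lift y n)"
  "subst (LiftLe u v P x y) s n = LiftLe u v (subst P s n) (subst x s n) (subst y s n)"
  "lift (UpperBound u v t P S y) n = UpperBound u v t (lift P n) (lift S n) (lift y n)"
  "subst (UpperBound u v t P S y) s n = UpperBound u v t (subst P s n) (subst S s n) (subst y s n)"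
  "lift (Least u v t P S y) n = Least u v t (lift P n) (lift S n) (lift y n)"
  "subst (Least u v t P S y) s n = Least u v t (subst P s n) (subst S s n) (subst y s n)"
  "lift (IsSup u v t P S y) n = IsSup u v t (lift P n) (lift S n) (lift y n)"
  "subst (IsSup u v t P S y) s n = IsSup u v t (subst P s n) (subst S s n) (subst y s n)"
  "lift (HasSups u v t P) n = HasSups u v t (lift P n)"
  "subst (HasSups u v t P) s n = HasSups u v t (subst P s n)"
  by (simp_all add: LiftT_def LiftProp_def LiftLe_def UpperBound_def Least_def IsSup_def HasSups_def)

section \<open>Typing of the lifting, its order and its suprema\<close>

lemma ty_omega_body:
  assumes "\<turnstile> \<Gamma>"
  shows "Univ v # \<Gamma> \<turnstile> IsProp v (Var 0) : Univ v"
  using ty_var0[OF ty_univ[OF assms]] by (intro ty_isProp) simp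

lemma ty_omega: "\<turnstile> \<Gamma> \<Longrightarrow> \<Gamma> \<turnstile> OmegaT v : Univ (Suc v)"
  unfolding OmegaT_def by (intro ty_sig[OF ty_univ ty_omega_body]) simp_all

lemma ty_holds: "\<Gamma> \<turnstile> q : OmegaT v \<Longrightarrow> \<Gamma> \<turnstile> Holds v q : Univ v"
  unfolding Holds_def OmegaT_def
  by (intro ty_pr1[OF ty_univ ty_omega_body] ctx_of_typing)

lemma eq_holds: "\<Gamma> \<turnstile> q : OmegaT v \<Longrightarrow> \<Gamma> \<turnstile> q \<equiv> q' : OmegaT v \<Longrightarrow> \<Gamma> \<turnstile> Holds v q \<equiv> Holds v q' : Univ v"
  unfolding Holds_def OmegaT_def
  by (intro eq_pr1[OF ty_univ ty_omega_body] ctx_of_typing)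

text \<open>The second component of \<open>q\<close> is the required element.\<close>

lemma holds_is_prop:
  assumes "\<Gamma> \<turnstile> q : OmegaT v"
  shows "\<exists>h. \<Gamma> \<turnstile> h : IsProp v (Holds v q)"
proof -
  have w: "\<turnstile> \<Gamma>" using assms by (rule ctx_of_typing)
  show ?thesis
    using ex_pr2[OF ty_univ[OF w] ty_omega_body[OF w] assms[unfolded OmegaT_def]]
    by (simp add: Holds_def)
qed

definition MkOmega :: "nat \<Rightarrow> tm \<Rightarrow> tm \<Rightarrow> tm" where
  "MkOmega v A h = Pair (Suc v) v (Univ v) (IsProp v (Var 0)) A h"

lemma MkOmega_simps [simp]:
  "lift (MkOmega v A h) n = MkOmega v (lift A n) (lift h n)"
  "subst (MkOmega v A h) s n = MkOmega v (subst A s n) (subst h s n)"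
  by (simp_all add: MkOmega_def)

lemma
  assumes "\<Gamma> \<turnstile> A : Univ v" "\<Gamma> \<turnstile> h : IsProp v A"
  shows ty_mkOmega: "\<Gamma> \<turnstile> MkOmega v A h : OmegaT v"
    and eq_holds_mkOmega: "\<Gamma> \<turnstile> Holds v (MkOmega v A h) \<equiv> A : Univ v"
  unfolding MkOmega_def OmegaT_def Holds_def using assms
  by (auto intro!: ty_pair eq_pr1_pair ty_univ ty_omega_body dest: ctx_of_typing)

lemma ty_lift_body:
  assumes P: "\<Gamma> \<turnstile> P : Univ u"
  shows "OmegaT v # \<Gamma> \<turnstile> Pi (Holds v (Var 0)) (lift (lift P 0) 0) : Univ (max v u)"
proof (rule ty_pi)
  have O: "\<Gamma> \<turnstile> OmegaT v : Univ (Suc v)" by (rule ty_omega[OF ctx_of_typing[OF P]])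
  show H: "OmegaT v # \<Gamma> \<turnstile> Holds v (Var 0) : Univ v"
    using ty_var0[OF O] by (intro ty_holds) simp
  show "Holds v (Var 0) # OmegaT v # \<Gamma> \<turnstile> lift (lift P 0) 0 : Univ u"
    by (intro weaken_univ[OF weaken_univ[OF P O] H])
qed

context
  fixes \<Gamma> P and u v :: nat
  assumes P: "\<Gamma> \<turnstile> P : Univ u"
begin

lemma ty_liftT: "\<Gamma> \<turnstile> LiftT u v P : Univ (lev u v)"
  unfolding LiftT_def
  by (rule ty_sig[OF ty_omega[OF ctx_of_typing[OF P]] ty_lift_body[OF P]]) simp

lemma ty_liftProp: "\<Gamma> \<turnstile> x : LiftT u v P \<Longrightarrow> \<Gamma> \<turnstile> LiftProp u v P x : OmegaT v"
  unfolding LiftT_def LiftProp_def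
  by (rule ty_pr1[OF ty_omega[OF ctx_of_typing[OF P]] ty_lift_body[OF P]])

lemma ty_liftLe:
  "\<Gamma> \<turnstile> x : LiftT u v P \<Longrightarrow> \<Gamma> \<turnstile> y : LiftT u v P \<Longrightarrow> \<Gamma> \<turnstile> LiftLe u v P x y : Univ v"
  unfolding LiftLe_def
  by (rule ty_pi'[OF _ weaken_univ]) (auto intro: ty_holds ty_liftProp)

lemma lift_implies:
  assumes "\<Gamma> \<turnstile> x : LiftT u v P"
  shows "\<exists>f. \<Gamma> \<turnstile> f : Pi (Holds v (LiftProp u v P x)) (lift P 0)"
  using ex_pr2[OF ty_omega[OF ctx_of_typing[OF P]] ty_lift_body[OF P] assms[unfolded LiftT_def],
      folded LiftProp_def]
  by simp

end

context
  fixes \<Gamma> P S y and u v t :: nat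
  assumes P: "\<Gamma> \<turnstile> P : Univ u" and S: "\<Gamma> \<turnstile> S : Pi (LiftT u v P) (OmegaT t)" and y: "\<Gamma> \<turnstile> y : LiftT u v P"
begin

lemma ty_upperBound: "\<Gamma> \<turnstile> UpperBound u v t P S y : Univ (sup_lev u v t)"
  unfolding UpperBound_def
proof (rule ty_pi'[OF ty_liftT[OF P] ty_pi])
  let ?L = "LiftT u v P"
  note L = ty_liftT[OF P]
  show H: "?L # \<Gamma> \<turnstile> Holds t (App (lift S 0) (Var 0)) : Univ t"
    using weaken_typing[OF S L] ty_var0[OF L] by (intro ty_holds) (auto intro!: ty_app')
  show "Holds t (App (lift S 0) (Var 0)) # ?L # \<Gamma> \<turnstile>
      LiftLe u v (lift (lift P 0) 0) (Var (Suc 0)) (lift (lift y 0) 0) : Univ v"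
    using ty_var1[OF L H] weaken_typing[OF weaken_typing[OF y L] H]
    by (intro ty_liftLe weaken_univ[OF weaken_univ[OF P L] H]) simp_all
qed simp

end

lemma ty_least:
  assumes P: "\<Gamma> \<turnstile> P : Univ u" and S: "\<Gamma> \<turnstile> S : Pi (LiftT u v P) (OmegaT t)" and y: "\<Gamma> \<turnstile> y : LiftT u v P"
  shows "\<Gamma> \<turnstile> Least u v t P S y : Univ (sup_lev u v t)"
  unfolding Least_def
proof (rule ty_pi'[OF ty_liftT[OF P] ty_pi])
  let ?L = "LiftT u v P" and ?B = "UpperBound u v t (lift P 0) (lift S 0) (Var 0)"
  note L = ty_liftT[OF P]
  show B: "?L # \<Gamma> \<turnstile> ?B : Univ (sup_lev u v t)"
    using weaken_typing[OF S L] ty_var0[OF L]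
    by (intro ty_upperBound weaken_univ[OF P L]) simp_all
  show "?B # ?L # \<Gamma> \<turnstile> LiftLe u v (lift (lift P 0) 0) (lift (lift y 0) 0) (Var (Suc 0)) : Univ v"
    using ty_var1[OF L B] weaken_typing[OF weaken_typing[OF y L] B]
    by (intro ty_liftLe weaken_univ[OF weaken_univ[OF P L] B]) simp_all
qed auto

lemma ty_isSup:
  assumes "\<Gamma> \<turnstile> P : Univ u" "\<Gamma> \<turnstile> S : Pi (LiftT u v P) (OmegaT t)" "\<Gamma> \<turnstile> y : LiftT u v P"
  shows "\<Gamma> \<turnstile> IsSup u v t P S y : Univ (sup_lev u v t)"
  unfolding IsSup_def
  by (intro ty_sig ty_upperBound weaken_univ[OF ty_least ty_upperBound] assms) simp

lemma ty_isSup_body: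
  assumes P: "\<Gamma> \<turnstile> P : Univ u" and S: "\<Gamma> \<turnstile> S : Pi (LiftT u v P) (OmegaT t)"
  shows "LiftT u v P # \<Gamma> \<turnstile> IsSup u v t (lift P 0) (lift S 0) (Var 0) : Univ (sup_lev u v t)"
  using weaken_typing[OF S ty_liftT[OF P]] ty_var0[OF ty_liftT[OF P]]
  by (intro ty_isSup weaken_univ[OF P ty_liftT[OF P]]) simp_all

text \<open>Abstracting over the hypothesis on suprema in the final term is legitimate only if that
  hypothesis is a type of some universe.\<close>

lemma ty_hasSups:
  assumes P: "\<Gamma> \<turnstile> P : Univ u"
  shows "\<exists>k. \<Gamma> \<turnstile> HasSups u v t P : Univ k"
proof -
  let ?L = "LiftT u v P"
  note L = ty_liftT[OF P]
  have D: "\<Gamma> \<turnstile> Pi ?L (OmegaT t) : Univ (max (lev u v) (Suc t))"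
    by (rule ty_pi[OF L ty_omega[OF ctx_ext[OF ctx_of_typing[OF P] L]]])
  note P1 = weaken_univ[OF P D]
  have "Pi ?L (OmegaT t) # \<Gamma> \<turnstile> Var 0 : Pi (LiftT u v (lift P 0)) (OmegaT t)"
    using ty_var0[OF D] by simp
  from ty_isSup_body[OF P1 this]
  have "Pi ?L (OmegaT t) # \<Gamma> \<turnstile> Sig (lev u v) (sup_lev u v t) (LiftT u v (lift P 0))
      (IsSup u v t (lift (lift P 0) 0) (Var (Suc 0)) (Var 0)) : Univ (sup_lev u v t)"
    by (intro ty_sig ty_liftT P1) simp_all
  from ty_pi[OF D this] show ?thesis
    unfolding HasSups_def by blast
qed

text \<open>The point \<open>p\<close> gives the element \<open>x\<close> with underlying
  proposition \<open>Unit v\<close>. It belongs to the constantly true subset, so \<open>b\<close>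
  yields \<open>x\<close> below \<open>y\<close>, and the element of \<open>Unit v\<close> is
  carried to \<open>y\<close>.\<close>

lemma upper_bound_of_all:
  assumes P: "\<Gamma> \<turnstile> P : Univ u" and p: "\<Gamma> \<turnstile> p : P" and y: "\<Gamma> \<turnstile> y : LiftT u v P"
    and h: "\<Gamma> \<turnstile> h : IsProp t (Unit t)"
    and b: "\<Gamma> \<turnstile> b : UpperBound u v t P (Lam (LiftT u v P) (MkOmega t (Unit t) (lift h 0))) y"
  shows "\<exists>e. \<Gamma> \<turnstile> e : Holds v (LiftProp u v P y)"
proof -
  let ?L = "LiftT u v P" and ?S = "Lam (LiftT u v P) (MkOmega t (Unit t) (lift h 0))"
  have w: "\<turnstile> \<Gamma>" using p by (rule ctx_of_typing)
  note L = ty_liftT[OF P, of v]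
  have S: "?L # \<Gamma> \<turnstile> MkOmega t (Unit t) (lift h 0) : OmegaT t"
    using weaken_typing[OF h L] by (intro ty_mkOmega ty_unit ctx_ext[OF w L]) simp
  obtain k where k: "\<Gamma> \<turnstile> k : IsProp v (Unit v)" using unit_is_prop[OF w] by blast
  let ?q = "MkOmega v (Unit v) k"
  have q: "\<Gamma> \<turnstile> ?q : OmegaT v" by (rule ty_mkOmega[OF ty_unit[OF w] k])
  \<comment> \<open>The domain is \<open>Holds v ?q\<close> rather than the judgmentally equal
    \<open>Unit v\<close>, so that the second component of \<open>x\<close> has its required type on
    the nose.\<close>
  have "\<Gamma> \<turnstile> Lam (Holds v ?q) (lift p 0) : subst (Pi (Holds v (Var 0)) (lift (lift P 0) 0)) ?q 0"
    using ty_lam[OF ty_holds[OF q] weaken_typing[OF p ty_holds[OF q]]] by simp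
  note x_parts = ty_omega[OF w] ty_lift_body[OF P] q this
  define x where "x = Pair (Suc v) (max v u) (OmegaT v) (Pi (Holds v (Var 0)) (lift (lift P 0) 0))
    ?q (Lam (Holds v ?q) (lift p 0))"
  have x: "\<Gamma> \<turnstile> x : ?L"
    unfolding x_def LiftT_def by (rule ty_pair[OF x_parts])
  have "\<Gamma> \<turnstile> LiftProp u v P x \<equiv> ?q : OmegaT v"
    unfolding x_def LiftProp_def by (rule eq_pr1_pair[OF x_parts])
  then have x_holds: "\<Gamma> \<turnstile> Holds v (LiftProp u v P x) \<equiv> Unit v : Univ v"
    by (rule eq_trans[OF eq_holds[OF ty_liftProp[OF P x]] eq_holds_mkOmega[OF ty_unit[OF w] k]])
  have Sx: "\<Gamma> \<turnstile> App ?S x : OmegaT t" using ty_app[OF ty_lam[OF L S] x] by simp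
  have "\<Gamma> \<turnstile> App ?S x \<equiv> MkOmega t (Unit t) h : OmegaT t"
    using eq_beta[OF L S x] by simp
  then have Sx_holds: "\<Gamma> \<turnstile> Holds t (App ?S x) \<equiv> Unit t : Univ t"
    by (rule eq_trans[OF eq_holds[OF Sx] eq_holds_mkOmega[OF ty_unit[OF w] h]])
  have "\<Gamma> \<turnstile> App b x : Pi (Holds t (App ?S x)) (LiftLe u v (lift P 0) (lift x 0) (lift y 0))"
    using ty_app[OF b[unfolded UpperBound_def] x] by simp
  \<comment> \<open>The point of \<open>Unit t\<close>, converted, proves membership of
    \<open>x\<close>; the point of \<open>Unit v\<close> below proves the proposition underlying
    \<open>x\<close>.\<close>
  from ty_app[OF this ty_conv[OF ty_star[OF w] eq_sym[OF Sx_holds]]]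
  have "\<Gamma> \<turnstile> App (App b x) (Const (Star t)) : LiftLe u v P x y" by simp
  from ty_app[OF this[unfolded LiftLe_def] ty_conv[OF ty_star[OF w] eq_sym[OF x_holds]]]
  show ?thesis by auto
qed

lemma small_if_hasSups:
  assumes P: "\<Gamma> \<turnstile> P : Univ u" and hP: "\<Gamma> \<turnstile> hP : IsProp u P" and hs: "\<Gamma> \<turnstile> hs : HasSups u v t P"
  shows "\<exists>e. \<Gamma> \<turnstile> e : Small u v P"
proof -
  let ?L = "LiftT u v P"
  have w: "\<turnstile> \<Gamma>" using P by (rule ctx_of_typing)
  note L = ty_liftT[OF P, of v]
  obtain h where h: "\<Gamma> \<turnstile> h : IsProp t (Unit t)" using unit_is_prop[OF w] by blast
  \<comment> \<open>The subset of all elements, as the constant map to the true proposition of level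
    \<open>t\<close>.\<close>
  define S where "S = Lam ?L (MkOmega t (Unit t) (lift h 0))"
  have S: "\<Gamma> \<turnstile> S : Pi ?L (OmegaT t)"
    unfolding S_def using weaken_typing[OF h L]
    by (intro ty_lam[OF L] ty_mkOmega ty_unit ctx_ext[OF w L]) simp
  note B = ty_isSup_body[OF P S]
  let ?B = "IsSup u v t (lift P 0) (lift S 0) (Var 0)"
  have s: "\<Gamma> \<turnstile> App hs S : Sig (lev u v) (sup_lev u v t) ?L ?B"
    using ty_app[OF hs[unfolded HasSups_def] S] by simp
  obtain y where y: "\<Gamma> \<turnstile> y : ?L" and "\<exists>d. \<Gamma> \<turnstile> d : subst ?B y 0"
    using ty_pr1[OF L B s] ex_pr2[OF L B s] by blast
  then obtain d where "\<Gamma> \<turnstile> d : IsSup u v t P S y" by auto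
  from ty_pr1[OF ty_upperBound[OF P S y] _ this[unfolded IsSup_def]]
  obtain b where b: "\<Gamma> \<turnstile> b : UpperBound u v t P S y"
    using weaken_univ[OF ty_least[OF P S y] ty_upperBound[OF P S y]] by blast
  let ?q = "LiftProp u v P y"
  note q = ty_liftProp[OF P y]
  obtain hq where hq: "\<Gamma> \<turnstile> hq : IsProp v (Holds v ?q)" using holds_is_prop[OF q] by blast
  obtain f where f: "\<Gamma> \<turnstile> f : Pi (Holds v ?q) (lift P 0)" using lift_implies[OF P y] by blast
  \<comment> \<open>For the map from \<open>P\<close> to the underlying proposition of
    \<open>y\<close>, a variable of type \<open>P\<close> plays the role of the point, so the data
    on \<open>y\<close> are weakened and the result is abstracted afterwards.\<close>
  have "\<exists>e. P # \<Gamma> \<turnstile> e : Holds v (LiftProp u v (lift P 0) (lift y 0))"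
    using weaken_typing[OF y P] weaken_typing[OF h P] weaken_typing[OF b P]
    by (intro upper_bound_of_all[OF weaken_univ[OF P P] ty_var0[OF P], of _ _ "lift h 0" t])
      (simp_all add: S_def)
  then obtain e where "P # \<Gamma> \<turnstile> e : lift (Holds v ?q) 0" by auto
  from prop_small[OF P ty_holds[OF q] hP hq f ty_lam[OF P this]] show ?thesis .
qed

theorem theorem6p1:
  fixes u v t :: nat
  shows "holds_in_UF
    (\<Prod>P:U u. is_prop u P \<rightarrow> has_subset_sups u v t P \<rightarrow> is_small u v P)"
proof -
  let ?P = "IsProp u (Var 0)" and ?H = "HasSups u v t (Var (Suc 0))"
  have U: "[] \<turnstile> Univ u : Univ (Suc u)" by (intro ty_univ ctx_empty)
  have v0: "[Univ u] \<turnstile> Var 0 : Univ u" using ty_var0[OF U] by simp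
  note I = ty_isProp[OF v0]
  have v1: "[?P, Univ u] \<turnstile> Var (Suc 0) : Univ u" using ty_var1[OF U I] by simp
  obtain k where H: "[?P, Univ u] \<turnstile> ?H : Univ k" using ty_hasSups[OF v1] by blast
  have "\<exists>e. [?H, ?P, Univ u] \<turnstile> e : Small u v (Var (Suc (Suc 0)))"
    using weaken_univ[OF v1 H] ty_var1[OF I H] ty_var0[OF H]
    by (intro small_if_hasSups) simp_all
  then obtain e where "[?H, ?P, Univ u] \<turnstile> e : Small u v (Var (Suc (Suc 0)))" ..
  from ty_lam[OF U ty_lam[OF I ty_lam[OF H this]]]
  have "[] \<turnstile> Lam (Univ u) (Lam ?P (Lam ?H e)) :
    Pi (Univ u) (Pi ?P (Pi ?H (Small u v (Var (Suc (Suc 0))))))" .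
  \<comment> \<open>Evaluating the named expression at depth 0 gives literally this raw type, so no
    conversion is involved.\<close>
  moreover have "Pi (Univ u) (Pi ?P (Pi ?H (Small u v (Var (Suc (Suc 0)))))) =
    (\<Prod>P:U u. is_prop u P \<rightarrow> has_subset_sups u v t P \<rightarrow> is_small u v P) 0"
    by (simp add: expr_simps IsProp_def Idt_def Small_def EquivT_def IsEquiv_def SectionT_def
      RetractionT_def HasSups_def IsSup_def Least_def UpperBound_def LiftLe_def LiftProp_def LiftT_def
      Holds_def OmegaT_def Pr1_def SigIndF_def Sig_def SigF_def Lift_def Lift_prop_def Lift_le_def
      is_upper_bound_def is_sup_def has_subset_sups_def is_equiv_def Equiv_def is_small_def Omega_def
      holds_def pr1_def times_def numeral_eq_Suc)
  ultimately show ?thesis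
    unfolding holds_in_UF_def by metis
qed

end
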